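(* Let $n\ge 0$ and let $p$ be a point of $\mathbb{R}^2\times(S^1)^{n+1}$. Then the local diffeomorphism $\phi^n=(\phi_1,\dots,\phi_{n+3})^T$, $(x_1,\dots,x_{n+3})=\phi^n(\xi_1,\xi_2,\theta_0,\dots,\theta_n)$, and the smooth functions $\nu_n,\eta_n,\mu_n$ constructed in the context around $p$ satisfy $$\phi^n_*(\tau_1^n)=(\nu_n\circ\psi^n)\,\kappa_1^{n+3},\qquad \phi^n_*(\tau_2^n)=(\eta_n\circ\psi^n)\,\kappa_1^{n+3}+(\mu_n\circ\psi^n)\,\kappa_2^{n+3}$$ for a Kumpera-Ruiz normal form $(\kappa_1^{n+3},\kappa_2^{n+3})$ on $\mathbb{R}^{n+3}$, where $\psi^n=(\phi^n)^{-1}$ and both $\nu_n$ and $\mu_n$ are non-zero at $p$; thus they convert locally the $n$-trailer system into a Kumpera-Ruiz normal form.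
   Context: Lifts. A vector field on a space with coordinates $(y_1,\dots,y_{m-1})$ is lifted to a space with one more coordinate $y_m$ by translating it along the $y_m$-direction (zero $\partial/\partial y_m$-component, coefficients independent of $y_m$); the lift is denoted by the same symbol. $n$-trailer system. On $\mathbb{R}^2\times (S^1)^{n+1}$ with coordinates $(\xi_1,\xi_2,\theta_0,\dots,\theta_n)$ it is the distribution spanned by $(\tau_1^n,\tau_2^n)$, where $\tau_1^0=\frac{\partial}{\partial\theta_0}$, $\tau_2^0=\cos(\theta_0)\frac{\partial}{\partial\xi_1}+\sin(\theta_0)\frac{\partial}{\partial\xi_2}$ and, inductively (with lifts), $\tau_1^i=\frac{\partial}{\partial\theta_i}$, $\tau_2^i=\sin(\theta_i-\theta_{i-1})\tau_1^{i-1}+\cos(\theta_i-\theta_{i-1})\tau_2^{i-1}$. Kumpera-Ruiz normal forms. On $\mathbb{R}^3$ put $\kappa_1^3=\frac{\partial}{\partial x_3}$, $\kappa_2^3=x_3\frac{\partial}{\partial x_2}+\frac{\partial}{\partial x_1}$. Given a pair $\kappa^{m-1}=(\kappa_1^{m-1},\kappa_2^{m-1})$ on $\mathbb{R}^{m-1}$, its regular prolongation with parameter $c\in\mathbb{R}$, $R_c(\kappa^{m-1})$, is the pair on $\mathbb{R}^m$ given by $\kappa_1^m=\frac{\partial}{\partial x_m}$, $\kappa_2^m=(x_m+c)\kappa_1^{m-1}+\kappa_2^{m-1}$; its singular prolongation $S(\kappa^{m-1})$ is given by $\kappa_1^m=\frac{\partial}{\partial x_m}$, $\kappa_2^m=\kappa_1^{m-1}+x_m\kappa_2^{m-1}$.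 A Kumpera-Ruiz normal form on $\mathbb{R}^m$ is a pair obtained from $\kappa^3$ by $m-3$ successive prolongations, each of them $S$ or some $R_{c}$ (or the restriction of such a pair to an open subset). Construction. Let $(\xi_1^p,\xi_2^p,\theta_0^p,\dots,\theta_n^p)$ be the coordinates of $p$, and $s_i=\sin(\theta_i-\theta_{i-1})$, $c_i=\cos(\theta_i-\theta_{i-1})$ for $1\le i\le n$. $\mathrm{L}_f$ denotes the Lie derivative along $f$. Start: if $\theta_0^p\ne\pm\pi/2 \bmod 2\pi$, put $\phi_1=\xi_1$, $\phi_2=\xi_2$, $\phi_3=\tan\theta_0$, $\mu_0=\cos\theta_0$, $\nu_0=\sec^2\theta_0$, $\eta_0=0$. If $\theta_0^p=\pm\pi/2\bmod 2\pi$, put $\phi_1=\xi_2$, $\phi_2=\xi_1$, $\phi_3=\cot\theta_0$, $\mu_0=\sin\theta_0$, $\nu_0=-\csc^2\theta_0$, $\eta_0=0$. Then for $1\le i\le n$, locally around $p$: regular case, $\theta_i^p-\theta_{i-1}^p\neq\pm\pi/2\bmod 2\pi$: $\phi_{i+3}=\dfrac{s_i\nu_{i-1}+c_i\eta_{i-1}}{c_i\mu_{i-1}}$, $\mu_i=c_i\mu_{i-1}$, $\nu_i=\mathrm{L}_{\tau_1^i}\phi_{i+3}$, $\eta_i=\mathrm{L}_{\tau_2^i}\phi_{i+3}$; singular case, $\theta_i^p-\theta_{i-1}^p=\pm\pi/2\bmod 2\pi$: $\phi_{i+3}=\dfrac{c_i\mu_{i-1}}{s_i\nu_{i-1}+c_i\eta_{i-1}}$,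 $\mu_i=s_i\nu_{i-1}+c_i\eta_{i-1}$, $\nu_i=\mathrm{L}_{\tau_1^i}\phi_{i+3}$, $\eta_i=\mathrm{L}_{\tau_2^i}\phi_{i+3}$. *)

theory Defs
  imports "HOL-Analysis.Analysis" "HOL-Library.Real_Mod"
begin

text \<open>
  Since the dimension varies in the recursive constructions below, Euclidean \<open>m\<close>-space is the
  library topology \<^const>\<open>Euclidean_space\<close> on sequences that vanish from index \<open>m\<close> on. The
  \<open>k\<close>-th coordinate of the mathematical text is the sequence entry with index \<open>k - 1\<close>.
  Functions and vector fields are total on sequences. One given by a formula in the
  first \<open>m - 1\<close> coordinates is also its own lift to \<open>m\<close>-space: it does not depend on
  the new coordinate, and a vector field has zero component there.
\<close>

type_synonym point = "nat \<Rightarrow> real"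
type_synonym scalar_field = "point \<Rightarrow> real"
type_synonym vector_field = "point \<Rightarrow> nat \<Rightarrow> real"

definition partial :: "nat \<Rightarrow> scalar_field \<Rightarrow> scalar_field" where
  "partial i f = (\<lambda>x. deriv (\<lambda>t. f (x(i := t))) (x i))"

primrec Ck_on :: "nat \<Rightarrow> nat \<Rightarrow> point set \<Rightarrow> scalar_field \<Rightarrow> bool" where
  "Ck_on 0 m U f \<longleftrightarrow> continuous_map (subtopology (Euclidean_space m) U) euclideanreal f"
| "Ck_on (Suc k) m U f \<longleftrightarrow>
     continuous_map (subtopology (Euclidean_space m) U) euclideanreal f \<and>
     (\<forall>i<m. (\<forall>x\<in>U. (\<lambda>t. f (x(i := t))) field_differentiable at (x i)) \<and>
            Ck_on k m U (partial i f))"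

text \<open>Meant for \<open>U\<close> open in \<open>m\<close>-space.\<close>

definition smooth_on :: "nat \<Rightarrow> point set \<Rightarrow> scalar_field \<Rightarrow> bool" where
  "smooth_on m U f \<longleftrightarrow> (\<forall>k. Ck_on k m U f)"

definition diffeomorphism ::
  "nat \<Rightarrow> point set \<Rightarrow> point set \<Rightarrow> (point \<Rightarrow> point) \<Rightarrow> (point \<Rightarrow> point) \<Rightarrow> bool" where
  "diffeomorphism m U V \<phi> \<psi> \<longleftrightarrow>
     openin (Euclidean_space m) U \<and> openin (Euclidean_space m) V \<and>
     \<phi> ` U = V \<and> \<psi> ` V = U \<and>
     (\<forall>q\<in>U. \<psi> (\<phi> q) = q) \<and> (\<forall>x\<in>V. \<phi> (\<psi> x) = x) \<and>
     (\<forall>j<m. smooth_on m U (\<lambda>q. \<phi> q j)) \<and> (\<forall>j<m. smooth_on m V (\<lambda>x. \<psi> x j))"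

definition coord_field :: "nat \<Rightarrow> vector_field" where
  "coord_field i = (\<lambda>x j. if j = i then 1 else 0)"

definition lin_comb ::
  "scalar_field \<Rightarrow> vector_field \<Rightarrow> scalar_field \<Rightarrow> vector_field \<Rightarrow> vector_field" where
  "lin_comb a f b g = (\<lambda>x j. a x * f x j + b x * g x j)"

definition Lie_deriv :: "nat \<Rightarrow> vector_field \<Rightarrow> scalar_field \<Rightarrow> scalar_field" where
  "Lie_deriv m f h = (\<lambda>x. \<Sum>j<m. f x j * partial j h x)"

text \<open>
  The pushforward of \<open>f\<close> under \<open>\<phi>\<close> with inverse \<open>\<psi>\<close>: at \<open>x\<close> it is the differential of \<open>\<phi>\<close> at
  \<open>\<psi> x\<close> applied to the vector \<open>f (\<psi> x)\<close>.
\<close>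

definition pushforward ::
  "nat \<Rightarrow> (point \<Rightarrow> point) \<Rightarrow> (point \<Rightarrow> point) \<Rightarrow> vector_field \<Rightarrow> vector_field" where
  "pushforward m \<phi> \<psi> f = (\<lambda>x j. if j < m then Lie_deriv m f (\<lambda>q. \<phi> q j) (\<psi> x) else 0)"

text \<open>The fibre at \<open>x\<close> of the distribution spanned by two vector fields.\<close>

definition distribution :: "vector_field \<Rightarrow> vector_field \<Rightarrow> point \<Rightarrow> (nat \<Rightarrow> real) set" where
  "distribution f g x = {(\<lambda>j. a * f x j + b * g x j) | a b. True}"

text \<open>The manifold \<open>\<real>\<^sup>2 \<times> (S\<^sup>1)\<^bsup>n+1\<^esup>\<close>, with \<open>S\<^sup>1\<close> the unit circle in the complex plane.\<close>

definition trailer_space :: "nat \<Rightarrow> ((real \<times> real) \<times> (nat \<Rightarrow> complex)) topology" where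
  "trailer_space n =
     prod_topology euclidean (product_topology (\<lambda>_. top_of_set (sphere 0 1)) {..n})"

text \<open>
  The point with coordinates \<open>(\<xi>\<^sub>1, \<xi>\<^sub>2, \<theta>\<^sub>0, \<dots>, \<theta>\<^sub>n)\<close>, the angles being determined
  only modulo \<open>2\<pi>\<close>. Local coordinates on the manifold arise by restricting this covering map
  to open sets on which it is a homeomorphism onto an open set.
\<close>

definition trailer_point :: "nat \<Rightarrow> point \<Rightarrow> (real \<times> real) \<times> (nat \<Rightarrow> complex)" where
  "trailer_point n q = ((q 0, q 1), (\<lambda>i\<in>{..n}. cis (q (i + 2))))"

definition coordinate_domain :: "nat \<Rightarrow> point set \<Rightarrow> bool" where
  "coordinate_domain n U \<longleftrightarrow>
     openin (Euclidean_space (n + 3)) U \<and>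
     openin (trailer_space n) (trailer_point n ` U) \<and>
     homeomorphic_map (subtopology (Euclidean_space (n + 3)) U)
       (subtopology (trailer_space n) (trailer_point n ` U)) (trailer_point n)"

abbreviation \<xi>\<^sub>1 :: scalar_field where "\<xi>\<^sub>1 q \<equiv> q 0"
abbreviation \<xi>\<^sub>2 :: scalar_field where "\<xi>\<^sub>2 q \<equiv> q 1"
abbreviation \<theta> :: "nat \<Rightarrow> scalar_field" where "\<theta> i q \<equiv> q (i + 2)"

definition \<tau>\<^sub>1 :: "nat \<Rightarrow> vector_field" where
  "\<tau>\<^sub>1 i = coord_field (i + 2)"

primrec \<tau>\<^sub>2 :: "nat \<Rightarrow> vector_field" where
  "\<tau>\<^sub>2 0 = lin_comb (\<lambda>q. cos (\<theta> 0 q)) (coord_field 0) (\<lambda>q. sin (\<theta> 0 q)) (coord_field 1)"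
| "\<tau>\<^sub>2 (Suc i) = lin_comb (\<lambda>q. sin (\<theta> (Suc i) q - \<theta> i q)) (\<tau>\<^sub>1 i)
                        (\<lambda>q. cos (\<theta> (Suc i) q - \<theta> i q)) (\<tau>\<^sub>2 i)"

text \<open>Both prolongations take a pair on \<open>m\<close>-space to a pair on \<open>m + 1\<close>-space, whose last
  coordinate has index \<open>m\<close>.\<close>

definition regular_prolongation ::
  "nat \<Rightarrow> real \<Rightarrow> vector_field \<times> vector_field \<Rightarrow> vector_field \<times> vector_field" where
  "regular_prolongation m c = (\<lambda>(k1, k2).
     (coord_field m, lin_comb (\<lambda>x. x m + c) k1 (\<lambda>_. 1) k2))"

definition singular_prolongation ::
  "nat \<Rightarrow> vector_field \<times> vector_field \<Rightarrow> vector_field \<times> vector_field" where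
  "singular_prolongation m = (\<lambda>(k1, k2).
     (coord_field m, lin_comb (\<lambda>_. 1) k1 (\<lambda>x. x m) k2))"

inductive kumpera_ruiz :: "nat \<Rightarrow> vector_field \<times> vector_field \<Rightarrow> bool" where
  base: "kumpera_ruiz 3
    (coord_field 2, lin_comb (\<lambda>x. x 2) (coord_field 1) (\<lambda>_. 1) (coord_field 0))"
| regular: "kumpera_ruiz m k \<Longrightarrow> kumpera_ruiz (Suc m) (regular_prolongation m c k)"
| singular: "kumpera_ruiz m k \<Longrightarrow> kumpera_ruiz (Suc m) (singular_prolongation m k)"

definition right_angle :: "real \<Rightarrow> bool" where
  "right_angle a \<longleftrightarrow> [a = pi / 2] (rmod 2 * pi) \<or> [a = - (pi / 2)] (rmod 2 * pi)"

text \<open>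
  \<open>phi p i\<close> is the component \<open>\<phi>\<^bsub>i+3\<^esub>\<close>. The coordinates \<open>p\<close> of the base point only decide
  between the regular and the singular formulas. All denominators that occur are
  \<open>mu p i\<close> for some \<open>i\<close>, apart from those of \<open>nu p 0\<close>, which are squares of \<open>mu p 0\<close>.
\<close>

fun phi mu nu eta :: "point \<Rightarrow> nat \<Rightarrow> scalar_field" where
  "phi p 0 = (if right_angle (\<theta> 0 p) then (\<lambda>q. cot (\<theta> 0 q)) else (\<lambda>q. tan (\<theta> 0 q)))"
| "mu p 0 = (if right_angle (\<theta> 0 p) then (\<lambda>q. sin (\<theta> 0 q)) else (\<lambda>q. cos (\<theta> 0 q)))"
| "nu p 0 = (if right_angle (\<theta> 0 p) then (\<lambda>q. - (1 / (sin (\<theta> 0 q))\<^sup>2))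
                                   else (\<lambda>q. 1 / (cos (\<theta> 0 q))\<^sup>2))"
| "eta p 0 = (\<lambda>q. 0)"
| "phi p (Suc i) =
    (if right_angle (\<theta> (Suc i) p - \<theta> i p)
     then (\<lambda>q. cos (\<theta> (Suc i) q - \<theta> i q) * mu p i q /
               (sin (\<theta> (Suc i) q - \<theta> i q) * nu p i q + cos (\<theta> (Suc i) q - \<theta> i q) * eta p i q))
     else (\<lambda>q. (sin (\<theta> (Suc i) q - \<theta> i q) * nu p i q + cos (\<theta> (Suc i) q - \<theta> i q) * eta p i q) /
               (cos (\<theta> (Suc i) q - \<theta> i q) * mu p i q)))"
| "mu p (Suc i) =
    (if right_angle (\<theta> (Suc i) p - \<theta> i p)
     then (\<lambda>q. sin (\<theta> (Suc i) q - \<theta> i q) * nu p i q + cos (\<theta> (Suc i) q - \<theta> i q) * eta p i q)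
     else (\<lambda>q. cos (\<theta> (Suc i) q - \<theta> i q) * mu p i q))"
| "nu p (Suc i) = Lie_deriv (i + 4) (\<tau>\<^sub>1 (Suc i)) (phi p (Suc i))"
| "eta p (Suc i) = Lie_deriv (i + 4) (\<tau>\<^sub>2 (Suc i)) (phi p (Suc i))"

definition phi_map :: "nat \<Rightarrow> point \<Rightarrow> point \<Rightarrow> point" where
  "phi_map n p q = (\<lambda>j.
     if j = 0 then (if right_angle (\<theta> 0 p) then \<xi>\<^sub>2 q else \<xi>\<^sub>1 q)
     else if j = 1 then (if right_angle (\<theta> 0 p) then \<xi>\<^sub>1 q else \<xi>\<^sub>2 q)
     else if j < n + 3 then phi p (j - 2) q
     else 0)"

end

theory Submission
  imports Defs "HOL-Homology.Invariance_of_Domain"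
begin

text \<open>
  The pushforward relations are identities between Lie derivatives of the components of \<open>\<phi>\<^sup>n\<close>, and
  they hold by induction on the number of trailers. Adding a trailer replaces \<open>\<tau>\<^sub>2\<^sup>i\<close> by
  \<open>s \<tau>\<^sub>1\<^sup>i + c \<tau>\<^sub>2\<^sup>i\<close>, where \<open>s\<close> and \<open>c\<close> are sine and cosine of the angle between the last two trailers.
  By the induction hypothesis this field acts on the old components as
  \<open>(s \<nu>\<^sub>i + c \<eta>\<^sub>i) \<kappa>\<^sub>1 + c \<mu>\<^sub>i \<kappa>\<^sub>2\<close>. One of the two coefficients is non-zero at \<open>p\<close>; it becomes \<open>\<mu>\<^bsub>i+1\<^esub>\<close>, and
  the quotient of the other one by it becomes the new coordinate. What is left after dividing by
  \<open>\<mu>\<^bsub>i+1\<^esub>\<close> is the second field of the regular prolongation with parameter \<open>0\<close>, or of the singular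
  prolongation (\<open>Lie_deriv_\<tau>\<^sub>2_chart\<close>).

  The new coordinate is a fractional linear function of the tangent of the hinge angle whose
  determinant is \<open>\<plusminus>\<mu>\<^sub>i \<nu>\<^sub>i\<close>. Hence \<open>\<nu>\<^bsub>i+1\<^esub> = \<plusminus>\<mu>\<^sub>i \<nu>\<^sub>i / \<mu>\<^bsub>i+1\<^esub>\<^sup>2\<close> (\<open>nu_Suc\<close>), and \<open>\<mu>\<^bsub>i+1\<^esub>\<close> and \<open>\<nu>\<^bsub>i+1\<^esub>\<close> inherit
  from \<open>\<mu>\<^sub>i\<close> and \<open>\<nu>\<^sub>i\<close> that they are non-zero at \<open>p\<close>. For the same reason the relation can be
  solved for the angle by an arctangent, with coefficients in the earlier variables
  (\<open>angle_from_chart_phi\<close>). So \<open>\<phi>\<^sup>n\<close> is injective where all \<open>\<mu>\<^sub>i\<close> are non-zero and every hinge angle stays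
  within \<open>\<pi>/2\<close> of a fixed centre. Its image is open by invariance of domain, and its inverse is smooth
  because the components of the inverse are smooth one after the other (\<open>diffeomorphism_phi_map\<close>).

  This needs a calculus of smooth functions on the finite-dimensional subspaces of the space of
  sequences, with a chain rule derived from continuity of the partial derivatives.
\<close>

section \<open>Functions of class \<open>C\<^sup>k\<close> on open sets of Euclidean space\<close>

lemma Euclidean_space_eq_top_of_set:
  "Euclidean_space m = top_of_set (topspace (Euclidean_space m))"
  by (simp add: Euclidean_space_def euclidean_product_topology)

lemma openin_Euclidean_spaceE:
  assumes "openin (Euclidean_space m) U"
  obtains T where "open T" "U = topspace (Euclidean_space m) \<inter> T"
  using assms by (subst (asm) Euclidean_space_eq_top_of_set) (auto simp: openin_open)

lemma continuous_map_Euclidean_open_iff: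
  assumes "openin (Euclidean_space m) U"
  shows "continuous_map (subtopology (Euclidean_space m) U) euclideanreal f \<longleftrightarrow> continuous_on U f"
proof -
  have "topspace (Euclidean_space m) \<inter> U = U"
    using openin_subset[OF assms] by auto
  then have "subtopology (Euclidean_space m) U = top_of_set U"
    by (subst Euclidean_space_eq_top_of_set) (simp add: subtopology_subtopology)
  then show ?thesis by simp
qed

lemma openin_Euclidean_fun_upd:
  assumes U: "openin (Euclidean_space m) U" and x: "x \<in> U" and i: "i < m"
  shows "\<forall>\<^sub>F t in nhds (x i). x(i := t) \<in> U"
proof -
  obtain T where T: "open T" "U = topspace (Euclidean_space m) \<inter> T"
    using openin_Euclidean_spaceE[OF U] .
  have "continuous_on UNIV (\<lambda>t. x(i := t))"
  proof (rule continuous_on_coordinatewise_then_product)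
    show "continuous_on UNIV (\<lambda>t. (x(i := t)) j)" for j
      by (cases "j = i") auto
  qed
  then have "open ((\<lambda>t. x(i := t)) -` T)"
    using T(1) by (simp add: open_vimage)
  moreover have "x i \<in> (\<lambda>t. x(i := t)) -` T"
    using x T by simp
  ultimately have "\<forall>\<^sub>F t in nhds (x i). x(i := t) \<in> T"
    by (auto simp: eventually_nhds)
  then show ?thesis
    by eventually_elim (use T x i in \<open>auto simp: topspace_Euclidean_space\<close>)
qed

lemma continuous_on_coordinate [continuous_intros]: "continuous_on A (\<lambda>x::point. x j)"
  by (rule continuous_on_subset[OF continuous_on_product_coordinates]) simp

lemma partial_eqI:
  "((\<lambda>t. f (x(i := t))) has_real_derivative d) (at (x i)) \<Longrightarrow> partial i f x = d"
  by (simp add: partial_def DERIV_imp_deriv)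

lemma Ck_on_imp_continuous_on:
  "openin (Euclidean_space m) U \<Longrightarrow> Ck_on k m U f \<Longrightarrow> continuous_on U f"
  by (cases k) (auto simp: continuous_map_Euclidean_open_iff)

lemma Ck_on_Suc_imp_partial:
  "Ck_on (Suc k) m U f \<Longrightarrow> i < m \<Longrightarrow> Ck_on k m U (partial i f)"
  by simp

lemma Ck_on_Suc_imp_DERIV:
  "Ck_on (Suc k) m U f \<Longrightarrow> i < m \<Longrightarrow> x \<in> U \<Longrightarrow>
     ((\<lambda>t. f (x(i := t))) has_real_derivative partial i f x) (at (x i))"
  by (auto simp: partial_def DERIV_deriv_iff_field_differentiable)

lemma Ck_on_cong:
  assumes "openin (Euclidean_space m) U" "\<And>x. x \<in> U \<Longrightarrow> f x = g x" "Ck_on k m U f"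
  shows "Ck_on k m U g"
  using assms(2,3)
proof (induction k arbitrary: f g)
  case 0
  then show ?case
    using assms(1) by (auto simp: continuous_map_Euclidean_open_iff cong: continuous_on_cong)
next
  case (Suc k)
  have ev: "\<forall>\<^sub>F t in nhds (x i). f (x(i := t)) = g (x(i := t))" if "x \<in> U" "i < m" for x i
    using openin_Euclidean_fun_upd[OF assms(1) that] by eventually_elim (rule Suc.prems)
  have par: "partial i f x = partial i g x" if "x \<in> U" "i < m" for x i
    using deriv_cong_ev[OF ev[OF that] refl] by (simp add: partial_def)
  have "(\<lambda>t. g (x(i := t))) field_differentiable at (x i)" if "x \<in> U" "i < m" for x i
    using Ck_on_Suc_imp_DERIV[OF Suc.prems(2) that(2,1)] DERIV_cong_ev[OF refl ev[OF that] refl]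
    by (auto simp only: field_differentiable_def)
  moreover have "Ck_on k m U (partial i g)" if "i < m" for i
    using Suc.IH[of "partial i f" "partial i g"] par that Suc.prems(2) by auto
  moreover have "continuous_on U g"
    using Ck_on_imp_continuous_on[OF assms(1) Suc.prems(2)] Suc.prems(1)
    by (auto cong: continuous_on_cong)
  ultimately show ?case
    by (simp add: continuous_map_Euclidean_open_iff[OF assms(1)])
qed

text \<open>
  All closure properties below reduce a function of class \<open>C\<^bsup>k+1\<^esup>\<close> to a formula for its partial
  derivatives, to which the induction hypothesis for \<open>k\<close> applies.
\<close>

lemma Ck_on_SucI:
  assumes "openin (Euclidean_space m) U" "continuous_on U f"
    and "\<And>i x. i < m \<Longrightarrow> x \<in> U \<Longrightarrow> ((\<lambda>t. f (x(i := t))) has_real_derivative g i x) (at (x i))"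
    and "\<And>i. i < m \<Longrightarrow> Ck_on k m U (g i)"
  shows "Ck_on (Suc k) m U f"
proof -
  have "Ck_on k m U (partial i f)" if "i < m" for i
    by (rule Ck_on_cong[OF assms(1) _ assms(4)[OF that]]) (metis assms(3) partial_eqI that)
  then show ?thesis
    using assms by (auto simp: continuous_map_Euclidean_open_iff field_differentiable_def)
qed

lemma Ck_on_SucD: "Ck_on (Suc k) m U f \<Longrightarrow> Ck_on k m U f"
  by (induction k arbitrary: f) auto

lemma Ck_on_mono: "Ck_on k m U f \<Longrightarrow> l \<le> k \<Longrightarrow> Ck_on l m U f"
  by (induction k) (auto simp: le_Suc_eq simp del: Ck_on.simps dest: Ck_on_SucD)

context
  fixes m :: nat and U :: "point set"
  assumes U: "openin (Euclidean_space m) U"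
begin

lemma Ck_on_const: "Ck_on k m U (\<lambda>_. c)"
proof (induction k arbitrary: c)
  case 0
  then show ?case by simp
next
  case (Suc k)
  show ?case
    by (rule Ck_on_SucI[OF U, where g = "\<lambda>_ _. 0"]) (auto intro: Suc)
qed

lemma Ck_on_coordinate: "Ck_on k m U (\<lambda>x. x j)"
proof (cases k)
  case 0
  then show ?thesis by (simp add: continuous_map_Euclidean_open_iff U continuous_on_coordinate)
next
  case (Suc k')
  show ?thesis unfolding Suc
  proof (rule Ck_on_SucI[OF U continuous_on_coordinate, where g = "\<lambda>i _. if i = j then 1 else 0"])
    show "((\<lambda>t. (x(i := t)) j) has_real_derivative (if i = j then 1 else 0)) (at (x i))" for i x
      by (cases "i = j") auto
  qed (rule Ck_on_const)
qed

lemma Ck_on_add: "Ck_on k m U f \<Longrightarrow> Ck_on k m U g \<Longrightarrow> Ck_on k m U (\<lambda>x. f x + g x)"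
proof (induction k arbitrary: f g)
  case 0
  then show ?case by (auto simp: continuous_map_Euclidean_open_iff[OF U] intro: continuous_on_add continuous_on_mult continuous_on_inverse continuous_on_sin continuous_on_cos continuous_on_arctan)
next
  case (Suc k)
  show ?case
  proof (rule Ck_on_SucI[OF U, where g = "\<lambda>i x. partial i f x + partial i g x"])
    show "continuous_on U (\<lambda>x. f x + g x)"
      using Suc.prems by (intro continuous_on_add Ck_on_imp_continuous_on[OF U])
    show "Ck_on k m U (\<lambda>x. partial i f x + partial i g x)" if "i < m" for i
      by (intro Suc.IH Suc.prems[THEN Ck_on_Suc_imp_partial, OF that])
    show "((\<lambda>t. f (x(i := t)) + g (x(i := t))) has_real_derivative
            partial i f x + partial i g x) (at (x i))" if "i < m" "x \<in> U" for i x
      by (intro DERIV_add Suc.prems[THEN Ck_on_Suc_imp_DERIV, OF that])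
  qed
qed

lemma Ck_on_sum:
  "(\<And>j. j \<in> J \<Longrightarrow> Ck_on k m U (f j)) \<Longrightarrow> Ck_on k m U (\<lambda>x. \<Sum>j\<in>J. f j x)"
  by (induction J rule: infinite_finite_induct) (auto intro: Ck_on_const Ck_on_add)

lemma Ck_on_mult: "Ck_on k m U f \<Longrightarrow> Ck_on k m U g \<Longrightarrow> Ck_on k m U (\<lambda>x. f x * g x)"
proof (induction k arbitrary: f g)
  case 0
  then show ?case by (auto simp: continuous_map_Euclidean_open_iff[OF U] intro: continuous_on_add continuous_on_mult continuous_on_inverse continuous_on_sin continuous_on_cos continuous_on_arctan)
next
  case (Suc k)
  show ?case
  proof (rule Ck_on_SucI[OF U, where g = "\<lambda>i x. f x * partial i g x + g x * partial i f x"])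
    show "continuous_on U (\<lambda>x. f x * g x)"
      using Suc.prems by (intro continuous_on_mult Ck_on_imp_continuous_on[OF U])
    show "Ck_on k m U (\<lambda>x. f x * partial i g x + g x * partial i f x)" if "i < m" for i
      by (intro Ck_on_add Suc.IH Suc.prems[THEN Ck_on_SucD]
          Suc.prems[THEN Ck_on_Suc_imp_partial, OF that])
    show "((\<lambda>t. f (x(i := t)) * g (x(i := t))) has_real_derivative
            f x * partial i g x + g x * partial i f x) (at (x i))" if "i < m" "x \<in> U" for i x
      by (rule DERIV_cong[OF DERIV_mult[OF Suc.prems[THEN Ck_on_Suc_imp_DERIV, OF that]]]) simp
  qed
qed

lemma Ck_on_minus: "Ck_on k m U f \<Longrightarrow> Ck_on k m U (\<lambda>x. - f x)"
  using Ck_on_mult[OF Ck_on_const[of k "-1"]] by simp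

lemma Ck_on_diff: "Ck_on k m U f \<Longrightarrow> Ck_on k m U g \<Longrightarrow> Ck_on k m U (\<lambda>x. f x - g x)"
  using Ck_on_add[OF _ Ck_on_minus] by simp

text \<open>
  For a function \<open>h\<close> of one variable it suffices that \<open>h' \<circ> f\<close> is of class \<open>C\<^sup>k\<close>, which
  for the elementary functions is an instance of the statement itself for a smaller \<open>k\<close>.
\<close>

lemma Ck_on_real_compose:
  assumes f: "Ck_on (Suc k) m U f"
    and h: "\<And>x. x \<in> U \<Longrightarrow> (h has_real_derivative h' (f x)) (at (f x))"
    and h': "Ck_on k m U (\<lambda>x. h' (f x))"
  shows "Ck_on (Suc k) m U (\<lambda>x. h (f x))"
proof (rule Ck_on_SucI[OF U, where g = "\<lambda>i x. h' (f x) * partial i f x"])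
  have "continuous_on (f ` U) h"
    using h by (auto intro!: continuous_at_imp_continuous_on DERIV_isCont)
  then show "continuous_on U (\<lambda>x. h (f x))"
    using Ck_on_imp_continuous_on[OF U f] by (rule continuous_on_compose2) simp
  show "Ck_on k m U (\<lambda>x. h' (f x) * partial i f x)" if "i < m" for i
    by (intro Ck_on_mult h' Ck_on_Suc_imp_partial[OF f that])
  show "((\<lambda>t. h (f (x(i := t)))) has_real_derivative h' (f x) * partial i f x) (at (x i))"
    if "i < m" "x \<in> U" for i x
    by (rule DERIV_chain2[OF _ Ck_on_Suc_imp_DERIV[OF f that]]) (use h[OF that(2)] in simp)
qed

lemma Ck_on_inverse:
  assumes "\<And>x. x \<in> U \<Longrightarrow> f x \<noteq> 0"
  shows "Ck_on k m U f \<Longrightarrow> Ck_on k m U (\<lambda>x. inverse (f x))"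
proof (induction k)
  case 0
  then show ?case
    using assms by (auto simp: continuous_map_Euclidean_open_iff[OF U] intro: continuous_on_add continuous_on_mult continuous_on_inverse continuous_on_sin continuous_on_cos continuous_on_arctan)
next
  case (Suc k)
  have "Ck_on k m U (\<lambda>x. - (inverse (f x) * inverse (f x)))"
    by (intro Ck_on_minus Ck_on_mult Suc.IH Ck_on_SucD[OF Suc.prems])
  moreover have "(inverse has_real_derivative - (inverse (f x) * inverse (f x))) (at (f x))"
    if "x \<in> U" for x
    using DERIV_inverse[OF assms[OF that]] by simp
  ultimately show ?case
    by (intro Ck_on_real_compose[OF Suc.prems])
qed

lemma Ck_on_divide:
  "Ck_on k m U f \<Longrightarrow> Ck_on k m U g \<Longrightarrow> (\<And>x. x \<in> U \<Longrightarrow> g x \<noteq> 0) \<Longrightarrow>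
     Ck_on k m U (\<lambda>x. f x / g x)"
  by (simp add: divide_inverse Ck_on_mult Ck_on_inverse)

lemma Ck_on_sin_cos:
  "Ck_on k m U f \<Longrightarrow> Ck_on k m U (\<lambda>x. sin (f x)) \<and> Ck_on k m U (\<lambda>x. cos (f x))"
proof (induction k)
  case 0
  then show ?case by (auto simp: continuous_map_Euclidean_open_iff[OF U] intro: continuous_on_add continuous_on_mult continuous_on_inverse continuous_on_sin continuous_on_cos continuous_on_arctan)
next
  case (Suc k)
  have "Ck_on k m U (\<lambda>x. sin (f x))" "Ck_on k m U (\<lambda>x. cos (f x))"
    using Suc.IH Ck_on_SucD[OF Suc.prems] by auto
  then show ?case
    using Ck_on_real_compose[OF Suc.prems, of sin cos]
      Ck_on_real_compose[OF Suc.prems, of cos "\<lambda>y. - sin y"]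
    by (simp add: Ck_on_minus del: Ck_on.simps(2))
qed

lemma Ck_on_arctan:
  assumes "Ck_on k m U f"
  shows "Ck_on k m U (\<lambda>x. arctan (f x))"
proof (cases k)
  case 0
  with assms show ?thesis
    by (auto simp: continuous_map_Euclidean_open_iff[OF U] intro: continuous_on_add continuous_on_mult continuous_on_inverse continuous_on_sin continuous_on_cos continuous_on_arctan)
next
  case (Suc k')
  have f: "Ck_on (Suc k') m U f"
    using assms Suc by (simp del: Ck_on.simps(2))
  have "1 + f x * f x \<noteq> 0" for x
    by (metis add_pos_nonneg less_irrefl zero_le_square zero_less_one)
  then have "Ck_on k' m U (\<lambda>x. inverse (1 + f x * f x))"
    by (intro Ck_on_inverse Ck_on_add Ck_on_mult Ck_on_const Ck_on_SucD[OF f])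
  then show ?thesis
    unfolding Suc
    by (intro Ck_on_real_compose[OF f, where h' = "\<lambda>y. inverse (1 + y * y)"])
      (use DERIV_arctan in \<open>auto simp: power2_eq_square\<close>)
qed

end

section \<open>The chain rule\<close>

text \<open>
  Independence of the coordinates from index \<open>r\<close> on. It is required globally, not only on an open
  set, so that it survives partial differentiation without any condition on the point.
\<close>

definition determined_by :: "nat \<Rightarrow> scalar_field \<Rightarrow> bool" where
  "determined_by r f \<longleftrightarrow> (\<forall>x y. (\<forall>j<r. x j = y j) \<longrightarrow> f x = f y)"

lemma determined_byD: "determined_by r f \<Longrightarrow> (\<And>j. j < r \<Longrightarrow> x j = y j) \<Longrightarrow> f x = f y"
  by (auto simp: determined_by_def)

lemma determined_by_fun_upd: "determined_by r f \<Longrightarrow> r \<le> j \<Longrightarrow> f (x(j := t)) = f x"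
  by (auto simp: determined_by_def)

lemma determined_by_mono: "determined_by r f \<Longrightarrow> r \<le> s \<Longrightarrow> determined_by s f"
  by (auto simp: determined_by_def)

lemma partial_beyond: "determined_by r f \<Longrightarrow> r \<le> j \<Longrightarrow> partial j f x = 0"
  by (simp add: partial_def determined_by_fun_upd)

lemma determined_by_partial:
  assumes "determined_by r f"
  shows "determined_by r (partial j f)"
  unfolding determined_by_def
proof (intro allI impI)
  fix x y :: point
  assume eq: "\<forall>i<r. x i = y i"
  show "partial j f x = partial j f y"
  proof (cases "j < r")
    case True
    have "f (x(j := t)) = f (y(j := t))" for t
      by (rule determined_byD[OF assms]) (use eq in auto)
    then show ?thesis
      using eq True by (simp add: partial_def)
  next
    case False
    then show ?thesis using partial_beyond[OF assms] by simp
  qed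
qed

lemma tendsto_fun_iff:
  fixes f :: "'b \<Rightarrow> 'a \<Rightarrow> real"
  shows "(f \<longlongrightarrow> l) F \<longleftrightarrow> (\<forall>j. ((\<lambda>p. f p j) \<longlongrightarrow> l j) F)"
  using limitin_componentwise[of "\<lambda>_. euclideanreal" UNIV f l F]
  by (simp add: euclidean_product_topology)

text \<open>
  The usual proof by changing one coordinate at a time. Only the first \<open>r\<close> components of the curve
  need to be differentiable when \<open>f\<close> does not depend on the others. This is what makes the
  inverse of a triangular map accessible: its components are shown to be smooth one after the
  other, so that at each stage only an initial segment of them is known to be smooth.
\<close>

lemma DERIV_along_curve:
  fixes \<gamma> :: "real \<Rightarrow> point"
  assumes U: "openin (Euclidean_space m) U" and f: "Ck_on (Suc 0) m U f"
    and r: "r \<le> m" "determined_by r f" and t0: "\<gamma> t0 \<in> U"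
    and \<gamma>: "\<And>j. j < r \<Longrightarrow> ((\<lambda>t. \<gamma> t j) has_real_derivative v j) (at t0)"
  shows "((\<lambda>t. f (\<gamma> t)) has_real_derivative (\<Sum>j<r. partial j f (\<gamma> t0) * v j)) (at t0)"
proof -
  \<comment> \<open>The curve with only its first \<open>k\<close> components moving.\<close>
  define z where "z k t = (\<lambda>j. if j < k then \<gamma> t j else \<gamma> t0 j)" for k t
  obtain T where T: "open T" "U = topspace (Euclidean_space m) \<inter> T"
    using openin_Euclidean_spaceE[OF U] .
  have "((\<lambda>t. f (z k t)) has_real_derivative (\<Sum>j<k. partial j f (\<gamma> t0) * v j)) (at t0)"
    if "k \<le> r" for k
    using that
  proof (induction k)
    case 0
    then show ?case by (simp add: z_def)
  next
    case (Suc k)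
    then have k: "k < r" "k < m"
      using r(1) by auto
    define w where "w s u = (z k s)(k := u)" for s u
    have w0: "w s (\<gamma> t0 k) = z k s" "w s (\<gamma> s k) = z (Suc k) s" "z k t0 = \<gamma> t0" for s
      by (auto simp: w_def z_def)
    have w00: "w t0 (\<gamma> t0 k) = \<gamma> t0"
      using w0 by metis
    have lim: "((\<lambda>(s, u). w s u) \<longlongrightarrow> \<gamma> t0) (nhds t0 \<times>\<^sub>F nhds (\<gamma> t0 k))"
    proof -
      have zlim: "((\<lambda>s. \<gamma> s j) \<longlongrightarrow> \<gamma> t0 j) (nhds t0)" if "j < r" for j
        using \<gamma>[OF that] by (metis DERIV_isCont isCont_def tendsto_at_iff_tendsto_nhds)
      have "((\<lambda>p. w (fst p) (snd p) j) \<longlongrightarrow> \<gamma> t0 j) (nhds t0 \<times>\<^sub>F nhds (\<gamma> t0 k))" for j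
      proof -
        consider "j = k" | "j < k" | "j > k" by linarith
        then show ?thesis
        proof cases
          case 1
          then show ?thesis by (simp add: w_def filterlim_snd)
        next
          case 2
          have "((\<lambda>p. \<gamma> (fst p) j) \<longlongrightarrow> \<gamma> t0 j) (nhds t0 \<times>\<^sub>F nhds (\<gamma> t0 k))"
            by (rule filterlim_compose[OF zlim filterlim_fst]) (use 2 k in auto)
          with 2 show ?thesis by (simp add: w_def z_def)
        next
          case 3
          then show ?thesis by (simp add: w_def z_def)
        qed
      qed
      then show ?thesis
        by (simp add: case_prod_unfold tendsto_fun_iff)
    qed
    have "\<forall>\<^sub>F p in nhds t0 \<times>\<^sub>F nhds (\<gamma> t0 k). w (fst p) (snd p) \<in> T"
      using topological_tendstoD[OF lim T(1)] t0 T(2) by (simp add: case_prod_unfold)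
    then have "\<forall>\<^sub>F p in nhds (t0, \<gamma> t0 k). w (fst p) (snd p) \<in> T"
      by (simp add: nhds_prod)
    then obtain e where e: "e > 0" "\<And>p. dist p (t0, \<gamma> t0 k) < e \<Longrightarrow> w (fst p) (snd p) \<in> T"
      by (auto simp: eventually_nhds_metric)
    define X Y where "X = ball t0 (e/2)" and "Y = ball (\<gamma> t0 k) (e/2)"
    have wU: "w s u \<in> U" if "s \<in> X" "u \<in> Y" for s u
    proof -
      have "dist (s, u) (t0, \<gamma> t0 k) \<le> dist s t0 + dist u (\<gamma> t0 k)"
        by (simp add: dist_Pair_Pair sqrt_sum_squares_le_sum)
      also have "\<dots> < e"
        using that by (simp add: X_def Y_def dist_commute)
      finally have "w s u \<in> T"
        using e(2) by fastforce
      moreover have "w s u \<in> topspace (Euclidean_space m)"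
        using t0 T(2) k by (auto simp: topspace_Euclidean_space w_def z_def)
      ultimately show ?thesis
        using T(2) by simp
    qed
    have cont: "continuous (at (t0, \<gamma> t0 k) within X \<times> Y)
        (\<lambda>(s, u). blinfun_mult_right (partial k f (w s u)))"
    proof -
      have "continuous_on U (partial k f)"
        using Ck_on_imp_continuous_on[OF U Ck_on_Suc_imp_partial[OF f k(2)]] .
      moreover have "filterlim (\<lambda>p. w (fst p) (snd p)) (nhds (\<gamma> t0)) (at (t0, \<gamma> t0 k) within X \<times> Y)"
        using lim by (auto simp: case_prod_unfold nhds_prod[symmetric] at_within_def
            intro: filterlim_mono inf_le1)
      moreover have "\<forall>\<^sub>F p in at (t0, \<gamma> t0 k) within X \<times> Y. w (fst p) (snd p) \<in> U"
        using wU by (simp add: eventually_at_filter mem_Times_iff)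
      ultimately have "((\<lambda>p. partial k f (w (fst p) (snd p))) \<longlongrightarrow> partial k f (\<gamma> t0))
          (at (t0, \<gamma> t0 k) within X \<times> Y)"
        using continuous_on_tendsto_compose t0 by blast
      then show ?thesis
        by (auto simp: w00 continuous_within case_prod_unfold
            intro: bounded_linear.tendsto[OF bounded_linear_blinfun_mult_right])
    qed
    (* Near (t0, gamma t0 k) the function f o w has a partial derivative in s at one point, by the
       induction hypothesis, and a continuous one in u; this gives total differentiability. *)
    have "((\<lambda>(s, u). f (w s u)) has_derivative
        (\<lambda>(ds, du). (\<Sum>j<k. partial j f (\<gamma> t0) * v j) * ds +
           blinfun_mult_right (partial k f (w t0 (\<gamma> t0 k))) du))
        (at (t0, \<gamma> t0 k) within X \<times> Y)"
    proof (rule has_derivative_partialsI[OF _ _ cont])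
      show "((\<lambda>s. f (w s (\<gamma> t0 k))) has_derivative (*) (\<Sum>j<k. partial j f (\<gamma> t0) * v j))
          (at t0 within X)"
        using Suc by (simp add: w0 has_field_derivative_def has_derivative_at_withinI)
      show "((\<lambda>u. f (w s u)) has_derivative blinfun_apply (blinfun_mult_right (partial k f (w s u))))
          (at u within Y)" if "s \<in> X" "u \<in> Y" for s u
        using Ck_on_Suc_imp_DERIV[OF f k(2) wU[OF that]]
        by (simp add: w_def has_field_derivative_def has_derivative_at_withinI)
    qed (use e in \<open>auto simp: Y_def\<close>)
    moreover have "at (t0, \<gamma> t0 k) within X \<times> Y = at (t0, \<gamma> t0 k)"
      by (rule at_within_open) (use e in \<open>auto simp: X_def Y_def open_Times\<close>)
    ultimately have D: "((\<lambda>(s, u). f (w s u)) has_derivative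
        (\<lambda>(ds, du). (\<Sum>j<k. partial j f (\<gamma> t0) * v j) * ds + partial k f (\<gamma> t0) * du))
        (at (t0, \<gamma> t0 k))"
      by (simp only: w00 blinfun_mult_right.rep_eq)
    have "((\<lambda>t. (t, \<gamma> t k)) has_derivative (\<lambda>d. (d, v k * d))) (at t0)"
      using \<gamma>[OF k(1)] by (auto simp: has_field_derivative_def intro: has_derivative_Pair)
    from has_derivative_compose[OF this D] have "((\<lambda>t. f (w t (\<gamma> t k))) has_derivative
        (\<lambda>d. (\<Sum>j<k. partial j f (\<gamma> t0) * v j) * d + partial k f (\<gamma> t0) * (v k * d))) (at t0)"
      by simp
    then show ?case
      unfolding has_field_derivative_def w0
      by (rule has_derivative_eq_rhs) (simp add: fun_eq_iff algebra_simps)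
  qed
  from this[of r] have "((\<lambda>t. f (z r t)) has_real_derivative (\<Sum>j<r. partial j f (\<gamma> t0) * v j)) (at t0)"
    by simp
  moreover have "f (z r t) = f (\<gamma> t)" for t
    by (rule determined_byD[OF r(2)]) (simp add: z_def)
  ultimately show ?thesis
    by simp
qed

lemma Ck_on_compose:
  assumes U: "openin (Euclidean_space m) U" and W: "openin (Euclidean_space l) W"
    and r: "r \<le> m" and \<psi>W: "\<psi> ` W \<subseteq> U" and cont: "continuous_on W \<psi>"
  shows "Ck_on k m U f \<Longrightarrow> determined_by r f \<Longrightarrow> (\<And>j. j < r \<Longrightarrow> Ck_on k l W (\<lambda>x. \<psi> x j)) \<Longrightarrow>
    Ck_on k l W (\<lambda>x. f (\<psi> x))"
proof (induction k arbitrary: f)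
  case 0
  then show ?case
    using continuous_on_compose2[OF _ cont \<psi>W, of f] U W
    by (simp add: continuous_map_Euclidean_open_iff)
next
  case (Suc k)
  show ?case
  proof (rule Ck_on_SucI[OF W, where g = "\<lambda>i x. \<Sum>j<r. partial j f (\<psi> x) * partial i (\<lambda>x. \<psi> x j) x"])
    show "continuous_on W (\<lambda>x. f (\<psi> x))"
      using continuous_on_compose2[OF Ck_on_imp_continuous_on[OF U Suc.prems(1)] cont \<psi>W] .
    have f1: "Ck_on (Suc 0) m U f"
      using Suc.prems(1) by (rule Ck_on_mono) simp
    show "((\<lambda>t. f (\<psi> (x(i := t)))) has_real_derivative
        (\<Sum>j<r. partial j f (\<psi> x) * partial i (\<lambda>x. \<psi> x j) x)) (at (x i))"
      if "i < l" "x \<in> W" for i x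
    proof -
      have \<psi>: "((\<lambda>t. \<psi> (x(i := t)) j) has_real_derivative partial i (\<lambda>x. \<psi> x j) x) (at (x i))"
        if "j < r" for j
        by (rule Ck_on_Suc_imp_DERIV[OF Suc.prems(3)[OF that] \<open>i < l\<close> \<open>x \<in> W\<close>])
      have "\<psi> (x(i := x i)) \<in> U"
        using \<psi>W \<open>x \<in> W\<close> by auto
      from DERIV_along_curve[OF U f1 r Suc.prems(2), of "\<lambda>t. \<psi> (x(i := t))", OF this \<psi>]
      show ?thesis by simp
    qed
    show "Ck_on k l W (\<lambda>x. \<Sum>j<r. partial j f (\<psi> x) * partial i (\<lambda>x. \<psi> x j) x)" if "i < l" for i
    proof (rule Ck_on_sum[OF W], rule Ck_on_mult[OF W])
      fix j assume j: "j \<in> {..<r}"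
      show "Ck_on k l W (\<lambda>x. partial j f (\<psi> x))"
      proof (rule Suc.IH)
        show "Ck_on k m U (partial j f)"
          using Ck_on_Suc_imp_partial[OF Suc.prems(1)] j r by simp
        show "determined_by r (partial j f)"
          by (rule determined_by_partial[OF Suc.prems(2)])
      qed (rule Suc.prems(3)[THEN Ck_on_SucD])
      show "Ck_on k l W (partial i (\<lambda>x. \<psi> x j))"
        using Ck_on_Suc_imp_partial[OF Suc.prems(3) that] j by simp
    qed
  qed
qed

section \<open>Smooth functions\<close>

lemma smooth_on_imp_continuous_on:
  "openin (Euclidean_space m) U \<Longrightarrow> smooth_on m U f \<Longrightarrow> continuous_on U f"
  unfolding smooth_on_def by (meson Ck_on_imp_continuous_on)

lemma smooth_on_partial: "smooth_on m U f \<Longrightarrow> i < m \<Longrightarrow> smooth_on m U (partial i f)"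
  unfolding smooth_on_def by (meson Ck_on_Suc_imp_partial)

lemma smooth_on_cong:
  "openin (Euclidean_space m) U \<Longrightarrow> (\<And>x. x \<in> U \<Longrightarrow> f x = g x) \<Longrightarrow> smooth_on m U f \<Longrightarrow> smooth_on m U g"
  using Ck_on_cong[of m U f g] by (auto simp: smooth_on_def)

context
  fixes m :: nat and U :: "point set"
  assumes U: "openin (Euclidean_space m) U"
begin

lemma smooth_on_const: "smooth_on m U (\<lambda>_. c)"
  by (simp add: smooth_on_def Ck_on_const[OF U])

lemma smooth_on_coordinate: "smooth_on m U (\<lambda>x. x j)"
  by (simp add: smooth_on_def Ck_on_coordinate[OF U])

lemma smooth_on_sum:
  "(\<And>j. j \<in> J \<Longrightarrow> smooth_on m U (f j)) \<Longrightarrow> smooth_on m U (\<lambda>x. \<Sum>j\<in>J. f j x)"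
  by (simp add: smooth_on_def Ck_on_sum[OF U])

lemma smooth_on_sin: "smooth_on m U f \<Longrightarrow> smooth_on m U (\<lambda>x. sin (f x))"
  by (simp add: smooth_on_def Ck_on_sin_cos[OF U])

lemma smooth_on_cos: "smooth_on m U f \<Longrightarrow> smooth_on m U (\<lambda>x. cos (f x))"
  by (simp add: smooth_on_def Ck_on_sin_cos[OF U])

lemma smooth_on_arctan: "smooth_on m U f \<Longrightarrow> smooth_on m U (\<lambda>x. arctan (f x))"
  by (simp add: smooth_on_def Ck_on_arctan[OF U])

context
  fixes f g :: scalar_field
  assumes f: "smooth_on m U f" and g: "smooth_on m U g"
begin

lemma smooth_on_add: "smooth_on m U (\<lambda>x. f x + g x)"
  using f g by (simp add: smooth_on_def Ck_on_add[OF U])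

lemma smooth_on_diff: "smooth_on m U (\<lambda>x. f x - g x)"
  using f g by (simp add: smooth_on_def Ck_on_diff[OF U])

lemma smooth_on_mult: "smooth_on m U (\<lambda>x. f x * g x)"
  using f g by (simp add: smooth_on_def Ck_on_mult[OF U])

lemma smooth_on_divide: "(\<And>x. x \<in> U \<Longrightarrow> g x \<noteq> 0) \<Longrightarrow> smooth_on m U (\<lambda>x. f x / g x)"
  using f g by (simp add: smooth_on_def Ck_on_divide[OF U])

end

end

lemma smooth_on_compose:
  assumes "openin (Euclidean_space m) U" "openin (Euclidean_space l) W"
    and "r \<le> m" "\<psi> ` W \<subseteq> U" "continuous_on W \<psi>"
    and "smooth_on m U f" "determined_by r f" "\<And>j. j < r \<Longrightarrow> smooth_on l W (\<lambda>x. \<psi> x j)"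
  shows "smooth_on l W (\<lambda>x. f (\<psi> x))"
  using assms(6-8) Ck_on_compose[OF assms(1-5)] by (simp add: smooth_on_def)

lemma smooth_on_Lie_deriv:
  assumes "openin (Euclidean_space m) U" "l \<le> m"
    and "\<And>j. j < l \<Longrightarrow> smooth_on m U (\<lambda>x. f x j)" "smooth_on m U h"
  shows "smooth_on m U (Lie_deriv l f h)"
  unfolding Lie_deriv_def
  using assms by (intro smooth_on_sum smooth_on_mult smooth_on_partial) auto

lemma openin_Euclidean_nonzero:
  assumes "openin (Euclidean_space m) U" "continuous_on U f"
  shows "openin (Euclidean_space m) {x \<in> U. f x \<noteq> (0::real)}"
proof -
  have "openin (top_of_set U) (U \<inter> f -` (- {0}))"
    using assms(2) by (intro continuous_openin_preimage_gen) auto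
  moreover have "subtopology (Euclidean_space m) U = top_of_set U"
    by (subst Euclidean_space_eq_top_of_set)
      (use openin_subset[OF assms(1)] in \<open>simp add: subtopology_subtopology Int_absorb1\<close>)
  moreover have "U \<inter> f -` (- {0}) = {x \<in> U. f x \<noteq> 0}"
    by auto
  ultimately show ?thesis
    using assms(1) openin_trans_full by metis
qed

section \<open>Local coordinates on the configuration space\<close>

lemma cis_notin_nonpos_Reals:
  assumes "\<bar>a\<bar> < pi"
  shows "cis a \<notin> \<real>\<^sub>\<le>\<^sub>0"
proof
  assume "cis a \<in> \<real>\<^sub>\<le>\<^sub>0"
  then have "Arg (cis a) = pi"
    by (auto simp: Arg_eq_pi complex_nonpos_Reals_iff complex_eq_iff cis.ctr order_less_le
        dest: sin_zero_abs_cos_one)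
  then show False
    using assms Arg_cis[of a] by (simp add: abs_less_iff)
qed

lemma index_cases:
  fixes j n :: nat
  obtains "j = 0" | "j = 1" | i where "j = i + 2" "i \<le> n" | "j \<ge> n + 3"
proof (cases "j < 2 \<or> j \<ge> n + 3")
  case False
  then have "j = (j - 2) + 2" "j - 2 \<le> n"
    by auto
  then show ?thesis by (rule that(3))
qed (use that in \<open>auto simp: less_2_cases_iff\<close>)

definition angle_box :: "nat \<Rightarrow> point \<Rightarrow> point set" where
  "angle_box n p = {q \<in> topspace (Euclidean_space (n + 3)). \<forall>i\<le>n. \<bar>\<theta> i q - \<theta> i p\<bar> < pi}"

text \<open>
  An open box of half-width \<open>\<pi>\<close> in the angles is a chart domain: the angles are recovered from
  the unit complex numbers as principal arguments relative to the centre of the box.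
\<close>

lemma angle_box_homeomorphic:
  fixes n p
  defines "slit \<equiv> {z \<in> topspace (trailer_space n). \<forall>i\<le>n. snd z i / cis (\<theta> i p) \<notin> \<real>\<^sub>\<le>\<^sub>0}"
  shows "openin (trailer_space n) slit"
    and "homeomorphic_map (subtopology (Euclidean_space (n + 3)) (angle_box n p))
           (subtopology (trailer_space n) slit) (trailer_point n)"
proof -
  let ?E = "Euclidean_space (n + 3)"
  define g where "g = (\<lambda>z j. if j < n + 3 then
      (if j = 0 then fst (fst z) else if j = 1 then snd (fst z)
       else p j + Arg (snd z (j - 2) / cis (p j))) else 0 :: real)"
  have angle: "continuous_map (trailer_space n) euclidean (\<lambda>z. snd z i / cis (\<theta> i p))"
    if "i \<le> n" for i
  proof -
    have "continuous_map (trailer_space n) (top_of_set (sphere 0 1)) (\<lambda>z. snd z i)"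
      unfolding trailer_space_def
      by (rule continuous_map_compose[OF continuous_map_snd continuous_map_product_projection,
            unfolded o_def]) (use that in auto)
    then have "continuous_map (trailer_space n) euclidean (\<lambda>z. snd z i)"
      by (simp add: continuous_map_in_subtopology)
    then show ?thesis
      using continuous_map_compose[of "trailer_space n" euclidean "\<lambda>z. snd z i" euclidean
          "\<lambda>w. w / cis (\<theta> i p)"]
      by (simp add: o_def continuous_intros)
  qed
  have "openin (trailer_space n) {z \<in> topspace (trailer_space n). snd z i / cis (\<theta> i p) \<in> - \<real>\<^sub>\<le>\<^sub>0}"
    if "i \<le> n" for i
    using openin_continuous_map_preimage[OF angle[OF that], of "- \<real>\<^sub>\<le>\<^sub>0"]
    by (simp add: open_Compl closed_nonpos_Reals_complex)
  then have "openin (trailer_space n) (\<Inter>i\<in>{..n}.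
      {z \<in> topspace (trailer_space n). snd z i / cis (\<theta> i p) \<in> - \<real>\<^sub>\<le>\<^sub>0})"
    by (intro openin_INT2) auto
  moreover have "(\<Inter>i\<in>{..n}. {z \<in> topspace (trailer_space n). snd z i / cis (\<theta> i p) \<in> - \<real>\<^sub>\<le>\<^sub>0}) = slit"
    by (auto simp: slit_def)
  ultimately show "openin (trailer_space n) slit"
    by simp
  have norm1: "cmod (snd z i) = 1" if "z \<in> slit" "i \<le> n" for z i
    using that by (cases z) (auto simp: slit_def trailer_space_def PiE_iff)
  have "continuous_map ?E (trailer_space n) (trailer_point n)"
    unfolding trailer_space_def continuous_map_pairwise o_def
  proof (intro conjI)
    have "continuous_map ?E euclidean (\<lambda>q. (q 0, q 1))"
      by (simp add: continuous_map_Euclidean_space_iff continuous_on_coordinate continuous_on_Pair)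
    then show "continuous_map ?E euclidean (\<lambda>q. fst (trailer_point n q))"
      by (simp add: trailer_point_def)
    show "continuous_map ?E (product_topology (\<lambda>_. top_of_set (sphere 0 1)) {..n})
        (\<lambda>q. snd (trailer_point n q))"
      unfolding continuous_map_componentwise
    proof (intro conjI ballI)
      fix i assume "i \<in> {..n}"
      moreover have "continuous_map ?E euclidean (\<lambda>q. cis (q (i + 2)))"
        by (simp add: continuous_map_Euclidean_space_iff continuous_intros)
      ultimately show "continuous_map ?E (top_of_set (sphere 0 1)) (\<lambda>q. snd (trailer_point n q) i)"
        by (simp add: trailer_point_def continuous_map_in_subtopology)
    qed (auto simp: trailer_point_def)
  qed
  moreover have "trailer_point n q \<in> slit" if "q \<in> angle_box n p" for q
    using that cis_notin_nonpos_Reals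
    by (auto simp: slit_def angle_box_def trailer_point_def trailer_space_def cis_divide)
  ultimately have tp: "continuous_map (subtopology ?E (angle_box n p)) (subtopology (trailer_space n) slit)
      (trailer_point n)"
    by (auto simp: continuous_map_in_subtopology continuous_map_from_subtopology)
  have "continuous_map (subtopology (trailer_space n) slit) euclideanreal (\<lambda>z. g z j)" if "j < n + 3" for j
  proof -
    consider "j = 0" | "j = 1" | i where "j = i + 2" "i \<le> n" | "j \<ge> n + 3"
      by (rule index_cases)
    then show ?thesis
    proof cases
      case 3
      have "continuous_map (subtopology (trailer_space n) slit) (top_of_set (- \<real>\<^sub>\<le>\<^sub>0))
          (\<lambda>z. snd z i / cis (\<theta> i p))"
        using angle[OF 3(2)] 3(2)
        by (auto simp: continuous_map_in_subtopology continuous_map_from_subtopology slit_def)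
      moreover have "continuous_map (top_of_set (- \<real>\<^sub>\<le>\<^sub>0)) euclideanreal (\<lambda>w. p j + Arg w)"
        by (auto intro!: continuous_on_add continuous_on_const continuous_on_Arg)
      ultimately have "continuous_map (subtopology (trailer_space n) slit) euclideanreal
          ((\<lambda>w. p j + Arg w) \<circ> (\<lambda>z. snd z i / cis (\<theta> i p)))"
        by (rule continuous_map_compose)
      with 3 show ?thesis
        by (simp add: g_def o_def)
    next
      case 1
      have "continuous_map (trailer_space n) euclideanreal (\<lambda>z. fst (fst z))"
        unfolding trailer_space_def
        by (rule continuous_map_compose[OF continuous_map_fst, where g = fst, unfolded o_def])
          (auto intro: continuous_intros)
      with 1 show ?thesis by (simp add: g_def continuous_map_from_subtopology)
    next
      case 2
      have "continuous_map (trailer_space n) euclideanreal (\<lambda>z. snd (fst z))"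
        unfolding trailer_space_def
        by (rule continuous_map_compose[OF continuous_map_fst, where g = snd, unfolded o_def])
          (auto intro: continuous_intros)
      with 2 show ?thesis by (simp add: g_def continuous_map_from_subtopology)
    qed (use that in simp)
  qed
  then have "continuous_map (subtopology (trailer_space n) slit) ?E
      (\<lambda>z j. if j < n + 3 then g z j else 0)"
    by (simp add: continuous_map_componentwise_Euclidean_space)
  moreover have "(\<lambda>z j. if j < n + 3 then g z j else 0) = g"
    by (auto simp: g_def fun_eq_iff)
  moreover have "g z \<in> angle_box n p" if "z \<in> slit" for z
  proof -
    have "\<bar>Arg (snd z i / cis (\<theta> i p))\<bar> < pi" if "i \<le> n" for i
    proof -
      have "snd z i / cis (\<theta> i p) \<notin> \<real>\<^sub>\<le>\<^sub>0"
        using \<open>z \<in> slit\<close> that by (simp add: slit_def)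
      then have "Arg (snd z i / cis (\<theta> i p)) \<noteq> pi"
        by (auto simp: Arg_eq_pi complex_nonpos_Reals_iff)
      then show ?thesis
        using Arg_bounded[of "snd z i / cis (\<theta> i p)"] by linarith
    qed
    then show ?thesis
      by (auto simp: angle_box_def g_def topspace_Euclidean_space)
  qed
  ultimately have g: "continuous_map (subtopology (trailer_space n) slit) (subtopology ?E (angle_box n p)) g"
    by (auto simp: continuous_map_in_subtopology)
  have "g (trailer_point n q) = q" if q: "q \<in> angle_box n p" for q
  proof
    fix j
    consider "j = 0" | "j = 1" | i where "j = i + 2" "i \<le> n" | "j \<ge> n + 3"
      by (rule index_cases)
    then show "g (trailer_point n q) j = q j"
    proof cases
      case 3
      have "\<bar>\<theta> i q - \<theta> i p\<bar> < pi"
        using q 3(2) by (simp add: angle_box_def)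
      then have "Arg (cis (\<theta> i q - \<theta> i p)) = \<theta> i q - \<theta> i p"
        by (intro Arg_cis) auto
      with 3 show ?thesis
        by (simp add: g_def trailer_point_def cis_divide)
    qed (use q in \<open>auto simp: g_def trailer_point_def angle_box_def topspace_Euclidean_space\<close>)
  qed
  moreover have "trailer_point n (g z) = z" if z: "z \<in> slit" for z
  proof -
    have "cis (\<theta> i p + Arg (snd z i / cis (\<theta> i p))) = snd z i" if "i \<le> n" for i
    proof -
      have "snd z i / cis (\<theta> i p) \<noteq> 0"
        using norm1[OF z that] by auto
      then have "cis (Arg (snd z i / cis (\<theta> i p))) = snd z i / cis (\<theta> i p)"
        using norm1[OF z that] by (simp add: cis_Arg sgn_div_norm norm_divide)
      then show ?thesis
        by (simp add: cis_mult[symmetric])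
    qed
    moreover have "snd z i = undefined" if "\<not> i \<le> n" for i
      using z that by (cases z) (auto simp: slit_def trailer_space_def PiE_iff extensional_def)
    ultimately have "snd (trailer_point n (g z)) = snd z"
      by (auto simp: trailer_point_def g_def fun_eq_iff restrict_def)
    then show ?thesis
      by (cases z) (auto simp: trailer_point_def g_def)
  qed
  ultimately have "homeomorphic_maps (subtopology ?E (angle_box n p)) (subtopology (trailer_space n) slit)
      (trailer_point n) g"
    using tp g by (auto simp: homeomorphic_maps_def)
  then show "homeomorphic_map (subtopology ?E (angle_box n p)) (subtopology (trailer_space n) slit)
      (trailer_point n)"
    by (auto simp: homeomorphic_map_maps)
qed

text \<open>
  Being a chart domain passes to open subsets, so the later shrinking of the box is harmless.
\<close>

lemma coordinate_domain_subset_angle_box: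
  assumes U: "openin (Euclidean_space (n + 3)) U" and sub: "U \<subseteq> angle_box n p"
  shows "coordinate_domain n U"
proof -
  let ?E = "Euclidean_space (n + 3)"
  obtain S where S: "openin (trailer_space n) S"
    and h: "homeomorphic_map (subtopology ?E (angle_box n p)) (subtopology (trailer_space n) S) (trailer_point n)"
    using angle_box_homeomorphic by blast
  have "openin (subtopology ?E (angle_box n p)) U"
    using U sub by (auto simp: openin_subtopology)
  then have op: "openin (subtopology (trailer_space n) S) (trailer_point n ` U)"
    using homeomorphic_imp_open_map[OF h] by (simp add: open_map_def)
  then have op': "openin (trailer_space n) (trailer_point n ` U)" and sS: "trailer_point n ` U \<subseteq> S"
    using S openin_trans_full openin_subset by (blast, fastforce)
  have "homeomorphic_map (subtopology (subtopology ?E (angle_box n p)) U)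
      (subtopology (subtopology (trailer_space n) S) (trailer_point n ` U)) (trailer_point n)"
    by (rule homeomorphic_map_subtopologies[OF h])
      (use openin_subset[OF U] openin_subset[OF op] sub in auto)
  moreover have "angle_box n p \<inter> U = U" "S \<inter> trailer_point n ` U = trailer_point n ` U"
    using sub sS by auto
  ultimately show ?thesis
    using U op' by (simp add: coordinate_domain_def subtopology_subtopology)
qed

section \<open>Right angles and branches of the arctangent\<close>

lemma right_angle_iff_cos: "right_angle a \<longleftrightarrow> cos a = 0"
proof -
  have "right_angle a \<longleftrightarrow> cos a = 0 \<and> (sin a = 1 \<or> sin a = -1)"
    unfolding right_angle_def cis_eq_iff[symmetric] by (auto simp: complex_eq_iff)
  moreover have "sin a = 1 \<or> sin a = -1" if "cos a = 0"
    using that sin_cos_squared_add[of a] by (simp add: power2_eq_1_iff)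
  ultimately show ?thesis by auto
qed

lemma sin_nonzero: "cos (a :: real) = 0 \<Longrightarrow> sin a \<noteq> 0"
  using sin_cos_squared_add[of a] by auto

text \<open>
  Centre of the interval of length \<open>\<pi>\<close> around \<open>a\<close> on which an angle is recovered from its tangent
  or cotangent: the multiple of \<open>\<pi>\<close> closest to \<open>a\<close>, where the tangent vanishes, or \<open>a\<close> itself
  if it is a right angle, where the cotangent vanishes.
\<close>

definition branch_centre :: "real \<Rightarrow> real" where
  "branch_centre a = (if right_angle a then a else pi * of_int (round (a / pi)))"

text \<open>
  Rounding gives the weak inequality, and equality would make \<open>a\<close> a right angle.
\<close>

lemma branch_centre_close: "\<bar>a - branch_centre a\<bar> < pi / 2"
proof (cases "right_angle a")
  case False
  let ?b = "pi * of_int (round (a / pi))"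
  have "\<bar>of_int (round (a / pi)) - a / pi\<bar> \<le> 1 / 2"
    by (rule of_int_round_abs_le)
  then have "pi * \<bar>of_int (round (a / pi)) - a / pi\<bar> \<le> pi / 2"
    using mult_left_mono[OF _ pi_ge_zero] by fastforce
  then have le: "\<bar>a - ?b\<bar> \<le> pi / 2"
    by (simp add: abs_mult[of pi, simplified, symmetric] algebra_simps abs_minus_commute)
  have "cos a = cos ?b * cos (a - ?b) - sin ?b * sin (a - ?b)"
    by (metis cos_add add.commute diff_add_cancel)
  moreover have "sin ?b = 0"
    by (metis mult.commute sin_zero_iff_int2)
  ultimately have "cos (a - ?b) \<noteq> 0"
    using False by (auto simp: right_angle_iff_cos)
  then have "\<bar>a - ?b\<bar> \<noteq> pi / 2"
    by (metis cos_abs_real cos_pi_half)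
  with le False show ?thesis
    by (simp add: branch_centre_def)
qed (simp add: branch_centre_def)

lemma angle_eq_arctan_tan:
  assumes "\<not> right_angle a" "\<bar>d - branch_centre a\<bar> < pi / 2"
  shows "cos d \<noteq> 0" "d = branch_centre a + arctan (sin d / cos d)"
proof -
  define b where "b = branch_centre a"
  have b: "sin b = 0"
    using assms(1) unfolding b_def branch_centre_def
    by (metis mult.commute sin_zero_iff_int2)
  have close: "- (pi / 2) < d - b" "d - b < pi / 2"
    using assms(2) unfolding b_def by linarith+
  then have pos: "cos (d - b) > 0"
    by (rule cos_gt_zero_pi)
  have c: "cos (d - b) = cos d * cos b" and s: "sin (d - b) = sin d * cos b"
    using b by (simp_all add: cos_diff sin_diff)
  show "cos d \<noteq> 0"
    using pos c by auto
  have "cos b \<noteq> 0"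
    using pos c by auto
  then have "tan (d - b) = sin d / cos d"
    by (simp add: tan_def c s)
  moreover have "arctan (tan (d - b)) = d - b"
    using close by (rule arctan_tan)
  ultimately show "d = branch_centre a + arctan (sin d / cos d)"
    by (simp add: b_def)
qed

lemma angle_eq_arctan_cot:
  assumes "right_angle a" "\<bar>d - branch_centre a\<bar> < pi / 2"
  shows "sin d \<noteq> 0" "d = branch_centre a - arctan (cos d / sin d)"
proof -
  define b where "b = branch_centre a"
  have b: "cos b = 0"
    using assms(1) by (simp add: b_def branch_centre_def right_angle_iff_cos)
  have close: "- (pi / 2) < d - b" "d - b < pi / 2"
    using assms(2) unfolding b_def by linarith+
  then have pos: "cos (d - b) > 0"
    by (rule cos_gt_zero_pi)
  have c: "cos (d - b) = sin d * sin b" and s: "sin (d - b) = - (cos d * sin b)"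
    using b by (simp_all add: cos_diff sin_diff)
  show "sin d \<noteq> 0"
    using pos c by auto
  have "sin b \<noteq> 0"
    using pos c by auto
  then have "tan (d - b) = - (cos d / sin d)"
    by (simp add: tan_def c s)
  moreover have "arctan (tan (d - b)) = d - b"
    using close by (rule arctan_tan)
  ultimately show "d = branch_centre a - arctan (cos d / sin d)"
    by (simp add: b_def arctan_minus)
qed

section \<open>The functions of the construction\<close>

text \<open>
  The angle that decides between the regular and the singular formulas at stage \<open>i\<close>.
\<close>

fun hinge :: "nat \<Rightarrow> scalar_field" where
  "hinge 0 q = \<theta> 0 q"
| "hinge (Suc i) q = \<theta> (Suc i) q - \<theta> i q"

lemma \<tau>\<^sub>2_beyond: "i + 2 \<le> j \<Longrightarrow> \<tau>\<^sub>2 i q j = 0"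
  by (induction i) (auto simp: lin_comb_def coord_field_def \<tau>\<^sub>1_def)

lemma determined_by_\<tau>\<^sub>2: "determined_by (i + 3) (\<lambda>q. \<tau>\<^sub>2 i q j)"
proof (induction i)
  case 0
  then show ?case by (auto simp: determined_by_def lin_comb_def coord_field_def)
next
  case (Suc i)
  then have "determined_by (Suc i + 3) (\<lambda>q. \<tau>\<^sub>2 i q j)"
    by (rule determined_by_mono) simp
  then show ?case
    by (auto simp: determined_by_def lin_comb_def \<tau>\<^sub>1_def coord_field_def)
qed

lemma determined_by_Lie_deriv:
  assumes "\<And>j. determined_by r (\<lambda>q. f q j)" "determined_by r h"
  shows "determined_by r (Lie_deriv l f h)"
  unfolding determined_by_def Lie_deriv_def
proof (intro allI impI sum.cong refl arg_cong2[where f = "(*)"])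
  fix x y :: point and j assume eq: "\<forall>j<r. x j = y j"
  show "f x j = f y j"
    using assms(1)[of j] eq by (auto simp: determined_by_def)
  show "partial j h x = partial j h y"
    using determined_by_partial[OF assms(2), of j] eq by (auto simp: determined_by_def)
qed

text \<open>
  At stage \<open>i\<close> only \<open>\<xi>\<^sub>1, \<xi>\<^sub>2, \<theta>\<^sub>0, \<dots>, \<theta>\<^sub>i\<close> occur, which are the coordinates with index below \<open>i + 3\<close>.
\<close>

lemma determined_by_construction:
  "determined_by (i + 3) (phi p i) \<and> determined_by (i + 3) (mu p i) \<and>
   determined_by (i + 3) (nu p i) \<and> determined_by (i + 3) (eta p i)"
proof (induction i)
  case 0
  then show ?case by (auto simp: determined_by_def)
next
  case (Suc i)
  have "determined_by (Suc i + 3) (mu p i)" "determined_by (Suc i + 3) (nu p i)"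
    "determined_by (Suc i + 3) (eta p i)"
    using Suc by (auto elim: determined_by_mono)
  then have "determined_by (Suc i + 3) (phi p (Suc i))" "determined_by (Suc i + 3) (mu p (Suc i))"
    unfolding phi.simps mu.simps determined_by_def by (smt (verit) add_Suc lessI less_Suc_eq add_2_eq_Suc' eval_nat_numeral(3) add_Suc_right)+
  moreover from this(1) have "determined_by (Suc i + 3) (nu p (Suc i))"
    unfolding nu.simps by (intro determined_by_Lie_deriv)
      (auto simp: \<tau>\<^sub>1_def coord_field_def determined_by_def)
  moreover from calculation(1) have "determined_by (Suc i + 3) (eta p (Suc i))"
    unfolding eta.simps by (intro determined_by_Lie_deriv determined_by_\<tau>\<^sub>2)
  ultimately show ?case by blast
qed

lemmas determined_by_phi = determined_by_construction[THEN conjunct1]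
  and determined_by_mu = determined_by_construction[THEN conjunct2, THEN conjunct1]
  and determined_by_nu = determined_by_construction[THEN conjunct2, THEN conjunct2, THEN conjunct1]
  and determined_by_eta = determined_by_construction[THEN conjunct2, THEN conjunct2, THEN conjunct2]

lemma Lie_deriv_lin_comb:
  "Lie_deriv l (lin_comb a f b g) h q = a q * Lie_deriv l f h q + b q * Lie_deriv l g h q"
  by (simp add: Lie_deriv_def lin_comb_def sum.distrib sum_distrib_left algebra_simps)

lemma Lie_deriv_coord_field:
  "i < l \<Longrightarrow> Lie_deriv l (coord_field i) h q = partial i h q"
  by (simp add: Lie_deriv_def coord_field_def if_distrib[of "\<lambda>c. c * _"] sum.delta cong: if_cong)

lemma Lie_deriv_extend:
  assumes "\<And>j. l \<le> j \<Longrightarrow> f q j = 0" "l \<le> m"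
  shows "Lie_deriv l f h q = Lie_deriv m f h q"
  unfolding Lie_deriv_def using assms by (intro sum.mono_neutral_left) auto

lemma nu_eq_partial:
  assumes "mu p i q \<noteq> 0"
  shows "nu p i q = partial (i + 2) (phi p i) q"
proof (cases i)
  case 0
  show ?thesis
  proof (cases "right_angle (\<theta> 0 p)")
    case True
    have "((\<lambda>t. cot t) has_real_derivative - inverse ((sin (\<theta> 0 q))\<^sup>2)) (at (\<theta> 0 q))"
      using assms True 0 by (intro DERIV_cot) simp
    then show ?thesis
      using True 0 by (intro partial_eqI[symmetric]) (simp add: inverse_eq_divide)
  next
    case False
    have "((\<lambda>t. tan t) has_real_derivative inverse ((cos (\<theta> 0 q))\<^sup>2)) (at (\<theta> 0 q))"
      using assms False 0 by (intro DERIV_tan) simp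
    then show ?thesis
      using False 0 by (intro partial_eqI[symmetric]) (simp add: inverse_eq_divide)
  qed
next
  case (Suc k)
  then show ?thesis
    by (simp add: \<tau>\<^sub>1_def Lie_deriv_coord_field add.commute)
qed

text \<open>
  Since \<open>\<mu>\<^sub>i\<close>, \<open>\<nu>\<^sub>i\<close>, \<open>\<eta>\<^sub>i\<close> do not involve \<open>\<theta>\<^bsub>i+1\<^esub>\<close>, the derivative of \<open>\<phi>\<^bsub>i+4\<^esub>\<close> along it is the
  derivative of a fractional linear function of \<open>tan (\<theta>\<^bsub>i+1\<^esub> - \<theta>\<^sub>i)\<close>, whose determinant is
  \<open>\<plusminus>\<mu>\<^sub>i \<nu>\<^sub>i\<close>.
\<close>

lemma nu_Suc:
  assumes "mu p i q \<noteq> 0" "mu p (Suc i) q \<noteq> 0"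
  shows "nu p (Suc i) q =
    (if right_angle (hinge (Suc i) p) then - (mu p i q * nu p i q) / (mu p (Suc i) q)\<^sup>2
     else mu p i q * nu p i q / (mu p (Suc i) q)\<^sup>2)"
proof -
  define d where "d = hinge (Suc i) q"
  define M N H where "M = mu p i q" and "N = nu p i q" and "H = eta p i q"
  have upd: "mu p i (q(i + 3 := t)) = M" "nu p i (q(i + 3 := t)) = N" "eta p i (q(i + 3 := t)) = H" for t
    using determined_by_mu[of i p] determined_by_nu[of i p] determined_by_eta[of i p]
    by (auto simp: M_def N_def H_def determined_by_fun_upd)
  have q: "q (i + 3) - q (i + 2) = d"
    by (simp add: d_def add.commute eval_nat_numeral)
  have idx: "Suc i + 2 = i + 3" by simp
  have nu: "nu p (Suc i) q = partial (i + 3) (phi p (Suc i)) q"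
    using nu_eq_partial[OF assms(2)] by (simp only: idx)
  have 1: "sin d * sin d + cos d * cos d = 1"
    by (metis power2_eq_square sin_cos_squared_add)
  have "M * (N * (cos d * cos d)) + M * (N * (sin d * sin d)) = M * N * (sin d * sin d + cos d * cos d)"
    by (simp only: distrib_left mult.assoc add.commute)
  then have 2: "M * (N * (cos d * cos d)) + M * (N * (sin d * sin d)) = M * N"
    unfolding 1 by simp
  show ?thesis
  proof (cases "right_angle (hinge (Suc i) p)")
    case True
    then have mu: "mu p (Suc i) q = sin d * N + cos d * H"
      by (simp add: d_def M_def N_def H_def)
    have "((\<lambda>t. cos (t - q (i + 2)) * M / (sin (t - q (i + 2)) * N + cos (t - q (i + 2)) * H))
        has_real_derivative - (M * N) / (sin d * N + cos d * H)\<^sup>2) (at (q (i + 3)))"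
    proof -
      have "- (sin d * M) * (sin d * N + cos d * H) - cos d * M * (cos d * N - sin d * H)
          = - (M * N)"
        using 2 by (simp add: algebra_simps)
      then show ?thesis
        using assms(2) unfolding mu
        by (auto intro!: derivative_eq_intros simp: q[simplified] power2_eq_square)
    qed
    then show ?thesis
      unfolding nu mu using True
      by (intro partial_eqI) (simp add: upd[simplified] M_def[symmetric] N_def[symmetric] idx)
  next
    case False
    then have mu: "mu p (Suc i) q = cos d * M"
      by (simp add: d_def M_def)
    have "((\<lambda>t. (sin (t - q (i + 2)) * N + cos (t - q (i + 2)) * H) / (cos (t - q (i + 2)) * M))
        has_real_derivative M * N / (cos d * M)\<^sup>2) (at (q (i + 3)))"
    proof -
      have "(cos d * N - sin d * H) * (cos d * M) - (sin d * N + cos d * H) * (- (sin d * M))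
          = M * N"
        using 2 by (simp add: algebra_simps)
      then show ?thesis
        using assms(2) unfolding mu
        by (auto intro!: derivative_eq_intros simp: q[simplified] power2_eq_square)
    qed
    then show ?thesis
      unfolding nu mu using False
      by (intro partial_eqI) (simp add: upd[simplified] M_def[symmetric] N_def[symmetric] idx)
  qed
qed

lemma nu_nonzero: "\<forall>k\<le>i. mu p k q \<noteq> 0 \<Longrightarrow> nu p i q \<noteq> 0"
proof (induction i)
  case 0
  then show ?case by (auto split: if_splits)
next
  case (Suc i)
  then show ?case
    using nu_Suc[of p i q] by (simp del: mu.simps nu.simps)
qed

text \<open>
  At \<open>p\<close> the two formulas for \<open>\<mu>\<^bsub>i+1\<^esub>\<close> complement each other: in the regular case \<open>cos\<close> of the hinge
  angle is non-zero, and in the singular case the summand with \<open>cos\<close> vanishes, which leaves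
  \<open>\<plusminus>\<nu>\<^sub>i\<close>.
\<close>

lemma mu_nonzero_base_point: "k \<le> i \<Longrightarrow> mu p k p \<noteq> 0"
proof (induction i arbitrary: k)
  case 0
  then show ?case
    using sin_nonzero[of "\<theta> 0 p"] by (auto simp: right_angle_iff_cos)
next
  case (Suc i)
  have "nu p i p \<noteq> 0"
    using Suc.IH by (intro nu_nonzero) auto
  then have "mu p (Suc i) p \<noteq> 0"
    using Suc.IH[of i] sin_nonzero[of "\<theta> (Suc i) p - \<theta> i p"] by (auto simp: right_angle_iff_cos)
  then show ?case
    using Suc by (auto simp: le_Suc_eq simp del: mu.simps)
qed

lemma smooth_on_\<tau>\<^sub>2:
  assumes "openin (Euclidean_space m) U"
  shows "smooth_on m U (\<lambda>q. \<tau>\<^sub>2 i q j)"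
proof (induction i)
  case 0
  show ?case unfolding \<tau>\<^sub>2.simps lin_comb_def coord_field_def
    by (intro smooth_on_add smooth_on_mult smooth_on_sin smooth_on_cos smooth_on_coordinate
        smooth_on_const assms)
next
  case (Suc i)
  then show ?case unfolding \<tau>\<^sub>2.simps lin_comb_def coord_field_def \<tau>\<^sub>1_def
    by (intro smooth_on_add smooth_on_mult smooth_on_sin smooth_on_cos smooth_on_diff smooth_on_coordinate
        smooth_on_const assms)
qed

lemma smooth_on_mu_Suc:
  assumes "openin (Euclidean_space m) U"
    and "smooth_on m U (mu p i)" "smooth_on m U (nu p i)" "smooth_on m U (eta p i)"
  shows "smooth_on m U (mu p (Suc i))"
  by (cases "right_angle (\<theta> (Suc i) p - \<theta> i p)"; simp only: mu.simps if_True if_False)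
    (intro smooth_on_add smooth_on_mult smooth_on_sin smooth_on_cos smooth_on_diff
      smooth_on_coordinate assms)+

lemma smooth_on_construction:
  assumes U: "openin (Euclidean_space m) U"
  shows "i + 3 \<le> m \<Longrightarrow> \<forall>k\<le>i. \<forall>q\<in>U. mu p k q \<noteq> 0 \<Longrightarrow>
    smooth_on m U (phi p i) \<and> smooth_on m U (mu p i) \<and>
    smooth_on m U (nu p i) \<and> smooth_on m U (eta p i)"
proof (induction i)
  case 0
  have sc: "smooth_on m U (\<lambda>q. sin (\<theta> 0 q))" "smooth_on m U (\<lambda>q. cos (\<theta> 0 q))"
    by (intro smooth_on_sin smooth_on_cos smooth_on_coordinate U)+
  show ?case
  proof (cases "right_angle (\<theta> 0 p)")
    case True
    then have nz: "sin (\<theta> 0 q) \<noteq> 0" if "q \<in> U" for q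
      using 0 that by auto
    have "smooth_on m U (\<lambda>q. cos (\<theta> 0 q) / sin (\<theta> 0 q))"
      "smooth_on m U (\<lambda>q. (- 1) / (sin (\<theta> 0 q) * sin (\<theta> 0 q)))"
      by (intro smooth_on_divide smooth_on_mult smooth_on_const sc U; simp add: nz[simplified])+
    then show ?thesis
      using True sc smooth_on_const[OF U, of 0] by (simp add: cot_def power2_eq_square)
  next
    case False
    then have nz: "cos (\<theta> 0 q) \<noteq> 0" if "q \<in> U" for q
      using 0 that by auto
    have "smooth_on m U (\<lambda>q. sin (\<theta> 0 q) / cos (\<theta> 0 q))"
      "smooth_on m U (\<lambda>q. 1 / (cos (\<theta> 0 q) * cos (\<theta> 0 q)))"
      by (intro smooth_on_divide smooth_on_mult smooth_on_const sc U; simp add: nz[simplified])+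
    then show ?thesis
      using False sc smooth_on_const[OF U, of 0] by (simp add: tan_def power2_eq_square)
  qed
next
  case (Suc i)
  have IH: "smooth_on m U (mu p i)" "smooth_on m U (nu p i)" "smooth_on m U (eta p i)"
    using Suc by auto
  have mu: "smooth_on m U (mu p (Suc i))"
    by (rule smooth_on_mu_Suc[OF U IH])
  have nz: "mu p (Suc i) q \<noteq> 0" if "q \<in> U" for q
    using Suc.prems(2) that by blast
  have phi: "smooth_on m U (phi p (Suc i))"
  proof (cases "right_angle (\<theta> (Suc i) p - \<theta> i p)")
    case True
    have "smooth_on m U (\<lambda>q. (cos (\<theta> (Suc i) q - \<theta> i q) * mu p i q) / mu p (Suc i) q)"
      by (intro smooth_on_divide smooth_on_mult smooth_on_cos smooth_on_diff
          smooth_on_coordinate U IH mu nz)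
    with True show ?thesis by simp
  next
    case False
    have "smooth_on m U (\<lambda>q. (sin (\<theta> (Suc i) q - \<theta> i q) * nu p i q + cos (\<theta> (Suc i) q - \<theta> i q) * eta p i q)
        / mu p (Suc i) q)"
      by (intro smooth_on_divide smooth_on_add smooth_on_mult smooth_on_sin smooth_on_cos smooth_on_diff
          smooth_on_coordinate U IH mu nz)
    with False show ?thesis by simp
  qed
  have "smooth_on m U (nu p (Suc i))" "smooth_on m U (eta p (Suc i))"
    unfolding nu.simps eta.simps \<tau>\<^sub>1_def coord_field_def using Suc.prems(1)
    by (intro smooth_on_Lie_deriv[OF U _ _ phi] smooth_on_\<tau>\<^sub>2[OF U] smooth_on_const[OF U]; simp)+
  with mu phi show ?case by blast
qed

text \<open>
  The conditions have to be added one at a time: \<open>\<mu>\<^bsub>i+1\<^esub>\<close> is known to be continuous only where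
  \<open>\<mu>\<^sub>0, \<dots>, \<mu>\<^sub>i\<close> are non-zero.
\<close>

lemma openin_mu_nonzero:
  assumes U: "openin (Euclidean_space m) U"
  shows "i + 3 \<le> m \<Longrightarrow> openin (Euclidean_space m) {q \<in> U. \<forall>k\<le>i. mu p k q \<noteq> 0}"
proof (induction i)
  case 0
  have "smooth_on m U (mu p 0)"
    using smooth_on_sin[OF U smooth_on_coordinate[OF U]]
      smooth_on_cos[OF U smooth_on_coordinate[OF U]] by simp
  then show ?case
    using openin_Euclidean_nonzero[OF U smooth_on_imp_continuous_on[OF U]] by simp
next
  case (Suc i)
  let ?R = "{q \<in> U. \<forall>k\<le>i. mu p k q \<noteq> 0}"
  have R: "openin (Euclidean_space m) ?R"
    using Suc by simp
  have "smooth_on m ?R (mu p (Suc i))"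
    using smooth_on_construction[OF R, of i p] Suc.prems by (intro smooth_on_mu_Suc R) auto
  then have "openin (Euclidean_space m) {q \<in> ?R. mu p (Suc i) q \<noteq> 0}"
    by (rule openin_Euclidean_nonzero[OF R smooth_on_imp_continuous_on[OF R]])
  moreover have "{q \<in> ?R. mu p (Suc i) q \<noteq> 0} = {q \<in> U. \<forall>k\<le>Suc i. mu p k q \<noteq> 0}"
    by (auto simp: le_Suc_eq simp del: mu.simps)
  ultimately show ?case
    by (simp only:)
qed

section \<open>The Kumpera-Ruiz normal form\<close>

text \<open>
  The components of \<^const>\<open>phi_map\<close> do not depend on the number of trailers, except that the
  sequence is cut off. The uncut sequence allows an induction on the stage in a fixed space.
\<close>

definition chart :: "point \<Rightarrow> nat \<Rightarrow> scalar_field" where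
  "chart p j q =
    (if j = 0 then (if right_angle (\<theta> 0 p) then \<xi>\<^sub>2 q else \<xi>\<^sub>1 q)
     else if j = 1 then (if right_angle (\<theta> 0 p) then \<xi>\<^sub>1 q else \<xi>\<^sub>2 q)
     else phi p (j - 2) q)"

lemma phi_map_eq_chart: "phi_map n p q j = (if j < n + 3 then chart p j q else 0)"
  by (simp add: phi_map_def chart_def)

lemma determined_by_chart:
  assumes "j < r" "2 \<le> r"
  shows "determined_by r (chart p j)"
proof (cases "j < 2")
  case True
  then show ?thesis
    using assms by (auto simp: less_2_cases_iff chart_def determined_by_def)
next
  case False
  have "determined_by (j - 2 + 3) (phi p (j - 2))"
    by (rule determined_by_phi)
  then have "determined_by r (phi p (j - 2))"
    by (rule determined_by_mono) (use assms False in simp)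
  with False show ?thesis
    by (auto simp: chart_def determined_by_def)
qed

text \<open>Every regular prolongation is taken with parameter \<open>0\<close>, since the coordinates are not centred at \<open>p\<close>.\<close>

primrec trailer_normal_form :: "point \<Rightarrow> nat \<Rightarrow> vector_field \<times> vector_field" where
  "trailer_normal_form p 0 =
     (coord_field 2, lin_comb (\<lambda>x. x 2) (coord_field 1) (\<lambda>_. 1) (coord_field 0))"
| "trailer_normal_form p (Suc i) =
     (if right_angle (hinge (Suc i) p)
      then singular_prolongation (i + 3) (trailer_normal_form p i)
      else regular_prolongation (i + 3) 0 (trailer_normal_form p i))"

lemma kumpera_ruiz_trailer_normal_form: "kumpera_ruiz (i + 3) (trailer_normal_form p i)"
proof (induction i)
  case 0
  then show ?case using kumpera_ruiz.base by simp
next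
  case (Suc i)
  then show ?case
    using kumpera_ruiz.regular[OF Suc] kumpera_ruiz.singular[OF Suc] by (simp del: hinge.simps)
qed

lemma fst_trailer_normal_form: "fst (trailer_normal_form p i) = coord_field (i + 2)"
  by (induction i)
    (auto simp: regular_prolongation_def singular_prolongation_def case_prod_unfold numeral_2_eq_2 numeral_3_eq_3)

lemma snd_trailer_normal_form_Suc:
  "snd (trailer_normal_form p (Suc i)) x j =
    (if right_angle (hinge (Suc i) p)
     then coord_field (i + 2) x j + x (i + 3) * snd (trailer_normal_form p i) x j
     else x (i + 3) * coord_field (i + 2) x j + snd (trailer_normal_form p i) x j)"
  by (simp add: regular_prolongation_def singular_prolongation_def case_prod_unfold lin_comb_def
      fst_trailer_normal_form del: hinge.simps)

lemma snd_trailer_normal_form_beyond: "i + 2 \<le> j \<Longrightarrow> snd (trailer_normal_form p i) x j = 0"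
proof (induction i)
  case 0
  then show ?case by (simp add: lin_comb_def coord_field_def)
next
  case (Suc i)
  then show ?case
    by (simp add: snd_trailer_normal_form_Suc coord_field_def del: trailer_normal_form.simps hinge.simps)
qed

lemma Lie_deriv_\<tau>\<^sub>1_chart:
  assumes "i + 3 \<le> m" "mu p i q \<noteq> 0" "j < i + 3"
  shows "Lie_deriv m (\<tau>\<^sub>1 i) (chart p j) q = nu p i q * coord_field (i + 2) x j"
proof -
  have eq: "Lie_deriv m (\<tau>\<^sub>1 i) (chart p j) q = partial (i + 2) (chart p j) q"
    unfolding \<tau>\<^sub>1_def using assms(1) by (intro Lie_deriv_coord_field) simp
  show ?thesis
  proof (cases "j = i + 2")
    case True
    then have "chart p j = phi p i"
      by (simp add: chart_def fun_eq_iff)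
    then show ?thesis
      using True eq nu_eq_partial[OF assms(2)] by (simp add: coord_field_def)
  next
    case False
    then have "determined_by (i + 2) (chart p j)"
      using assms(3) by (intro determined_by_chart) auto
    then show ?thesis
      using False eq partial_beyond by (simp add: coord_field_def)
  qed
qed

text \<open>
  Write \<open>s, c\<close> for sine and cosine of the hinge angle and \<open>\<kappa>\<^sub>1, \<kappa>\<^sub>2\<close> for the normal form at
  stage \<open>i\<close>. On the components up to stage \<open>i\<close> the recursion
  \<open>\<tau>\<^sub>2\<^bsup>i+1\<^esup> = s \<tau>\<^sub>1\<^bsup>i\<^esup> + c \<tau>\<^sub>2\<^bsup>i\<^esup>\<close> and the induction hypothesis yield
  \<open>(s \<nu>\<^sub>i + c \<eta>\<^sub>i) \<kappa>\<^sub>1 + c \<mu>\<^sub>i \<kappa>\<^sub>2\<close>. One of the two coefficients is \<open>\<mu>\<^bsub>i+1\<^esub>\<close>, and the quotient of the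
  other by it is the new coordinate, so the sum is \<open>\<mu>\<^bsub>i+1\<^esub>\<close> times the second field of the
  prolongation. On the new component that field is zero, and the Lie derivative is \<open>\<eta>\<^bsub>i+1\<^esub>\<close> by
  definition.
\<close>

lemma Lie_deriv_\<tau>\<^sub>2_chart:
  assumes "i + 3 \<le> m" "\<forall>k\<le>i. mu p k q \<noteq> 0" "\<And>j. j < i + 3 \<Longrightarrow> x j = chart p j q" "j < i + 3"
  shows "Lie_deriv m (\<tau>\<^sub>2 i) (chart p j) q =
    eta p i q * coord_field (i + 2) x j + mu p i q * snd (trailer_normal_form p i) x j"
  using assms
proof (induction i arbitrary: j)
  case 0
  have part: "partial k (\<lambda>q. q l) q = (if k = l then 1 else 0)" for k l
    by (rule partial_eqI) (cases "k = l"; simp)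
  have x: "x 2 = phi p 0 q"
    using "0.prems"(3)[of 2] by (simp add: chart_def)
  have L: "Lie_deriv m (\<tau>\<^sub>2 0) h q = cos (\<theta> 0 q) * partial 0 h q + sin (\<theta> 0 q) * partial 1 h q" for h
    using 0 by (simp add: Lie_deriv_lin_comb Lie_deriv_coord_field)
  have phi0: "partial k (phi p 0) q = 0" if "k < 2" for k
    by (rule partial_eqI) (use that in auto)
  consider "j = 0" | "j = 1" | "j = 2"
    using "0.prems"(4) by linarith
  then show ?case
  proof cases
    case 1
    then have "chart p j = (if right_angle (\<theta> 0 p) then (\<lambda>q. q 1) else (\<lambda>q. q 0))"
      by (simp add: chart_def fun_eq_iff)
    then show ?thesis
      using 1 by (simp add: L part lin_comb_def coord_field_def del: \<tau>\<^sub>2.simps)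
  next
    case 2
    then have "chart p j = (if right_angle (\<theta> 0 p) then (\<lambda>q. q 0) else (\<lambda>q. q 1))"
      by (simp add: chart_def fun_eq_iff)
    moreover have "mu p 0 q * phi p 0 q = (if right_angle (\<theta> 0 p) then cos (\<theta> 0 q) else sin (\<theta> 0 q))"
      using "0.prems"(2) by (auto simp: tan_def cot_def split: if_splits)
    ultimately show ?thesis
      using 2 by (simp add: L part lin_comb_def coord_field_def x del: \<tau>\<^sub>2.simps mu.simps phi.simps)
  next
    case 3
    then have "chart p j = phi p 0"
      by (simp add: chart_def fun_eq_iff)
    then show ?thesis
      using 3 by (simp add: L phi0 lin_comb_def coord_field_def del: \<tau>\<^sub>2.simps mu.simps phi.simps)
  qed
next
  case (Suc i)
  let ?s = "sin (\<theta> (Suc i) q - \<theta> i q)" and ?c = "cos (\<theta> (Suc i) q - \<theta> i q)"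
  have nz: "mu p (Suc i) q \<noteq> 0"
    using Suc.prems(2) by blast
  show ?case
  proof (cases "j = i + 3")
    case True
    then have "chart p j = phi p (Suc i)"
      by (simp add: chart_def fun_eq_iff del: phi.simps)
    moreover have "Lie_deriv m (\<tau>\<^sub>2 (Suc i)) h q = Lie_deriv (i + 4) (\<tau>\<^sub>2 (Suc i)) h q" for h
      by (rule Lie_deriv_extend[symmetric]) (use Suc.prems(1) \<tau>\<^sub>2_beyond in \<open>auto simp del: \<tau>\<^sub>2.simps\<close>)
    ultimately show ?thesis
      using True by (simp add: snd_trailer_normal_form_beyond coord_field_def
          del: phi.simps mu.simps trailer_normal_form.simps \<tau>\<^sub>2.simps)
  next
    case False
    then have j: "j < i + 3"
      using Suc.prems(4) by simp
    have IH: "Lie_deriv m (\<tau>\<^sub>2 i) (chart p j) q =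
        eta p i q * coord_field (i + 2) x j + mu p i q * snd (trailer_normal_form p i) x j"
      by (rule Suc.IH) (use Suc.prems j in auto)
    have "Lie_deriv m (\<tau>\<^sub>2 (Suc i)) (chart p j) q =
        ?s * (nu p i q * coord_field (i + 2) x j) +
        ?c * (eta p i q * coord_field (i + 2) x j + mu p i q * snd (trailer_normal_form p i) x j)"
      unfolding \<tau>\<^sub>2.simps Lie_deriv_lin_comb IH
      using Lie_deriv_\<tau>\<^sub>1_chart[of i m p q j x] Suc.prems j by (simp del: mu.simps)
    also have "\<dots> = (?s * nu p i q + ?c * eta p i q) * coord_field (i + 2) x j +
        (?c * mu p i q) * snd (trailer_normal_form p i) x j"
      by (simp add: algebra_simps)
    also have "\<dots> = mu p (Suc i) q * snd (trailer_normal_form p (Suc i)) x j"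
    proof -
      have x: "x (i + 3) = phi p (Suc i) q"
        using Suc.prems(3)[of "i + 3"] by (simp add: chart_def del: phi.simps)
      show ?thesis
      proof (cases "right_angle (hinge (Suc i) p)")
        case True
        then have "mu p (Suc i) q * x (i + 3) = ?c * mu p i q" "mu p (Suc i) q = ?s * nu p i q + ?c * eta p i q"
          using nz unfolding x by auto
        with True show ?thesis
          by (simp add: snd_trailer_normal_form_Suc distrib_left mult.assoc[symmetric] del: mu.simps hinge.simps trailer_normal_form.simps)
      next
        case False
        then have "mu p (Suc i) q * x (i + 3) = ?s * nu p i q + ?c * eta p i q" "mu p (Suc i) q = ?c * mu p i q"
          using nz unfolding x by auto
        with False show ?thesis
          by (simp add: snd_trailer_normal_form_Suc distrib_left mult.assoc[symmetric] del: mu.simps hinge.simps trailer_normal_form.simps)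
      qed
    qed
    finally show ?thesis
      using j by (simp add: coord_field_def del: mu.simps trailer_normal_form.simps)
  qed
qed

section \<open>The inverse of the coordinate change\<close>

text \<open>
  The box makes the angles local coordinates on the configuration space, the bound on the hinge
  angles selects one branch of the arctangent at every stage, and the last condition keeps all
  denominators away from zero.
\<close>

definition chart_domain :: "nat \<Rightarrow> point \<Rightarrow> point set" where
  "chart_domain n p = {q \<in> angle_box n p.
     (\<forall>i\<le>n. \<bar>hinge i q - branch_centre (hinge i p)\<bar> < pi / 2) \<and> (\<forall>k\<le>n. mu p k q \<noteq> 0)}"

lemma openin_chart_domain: "openin (Euclidean_space (n + 3)) (chart_domain n p)"
proof -
  let ?E = "Euclidean_space (n + 3)"
  have hinge: "continuous_on UNIV (hinge i)" for i
    by (cases i) (auto intro: continuous_intros simp: fun_eq_iff)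
  define T where "T = (\<Inter>i\<in>{..n}. {q. \<bar>\<theta> i q - \<theta> i p\<bar> < pi} \<inter>
      {q. \<bar>hinge i q - branch_centre (hinge i p)\<bar> < pi / 2})"
  have "open T"
    unfolding T_def
    by (intro open_INT ballI open_Int open_Collect_less continuous_intros hinge) auto
  then have "openin ?E (topspace ?E \<inter> T)"
    by (subst Euclidean_space_eq_top_of_set) (auto simp: openin_open)
  then have "openin ?E {q \<in> topspace ?E \<inter> T. \<forall>k\<le>n. mu p k q \<noteq> 0}"
    by (rule openin_mu_nonzero) simp
  moreover have "{q \<in> topspace ?E \<inter> T. \<forall>k\<le>n. mu p k q \<noteq> 0} = chart_domain n p"
    by (auto simp: chart_domain_def angle_box_def T_def)
  ultimately show ?thesis by simp
qed

text \<open>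
  The inverse step of the coordinate change: \<open>\<theta>\<^sub>i\<close> from the new coordinate \<open>y\<close> and the earlier
  coordinates of \<open>q\<close>, obtained by solving the fractional linear relation between \<open>y\<close> and the
  tangent or cotangent of the hinge angle.
\<close>

fun angle_from_chart :: "point \<Rightarrow> nat \<Rightarrow> real \<Rightarrow> scalar_field" where
  "angle_from_chart p 0 y q =
    (if right_angle (hinge 0 p) then branch_centre (hinge 0 p) - arctan y
     else branch_centre (hinge 0 p) + arctan y)"
| "angle_from_chart p (Suc i) y q = \<theta> i q +
    (if right_angle (hinge (Suc i) p)
     then branch_centre (hinge (Suc i) p) - arctan (y * nu p i q / (mu p i q - y * eta p i q))
     else branch_centre (hinge (Suc i) p) + arctan ((y * mu p i q - eta p i q) / nu p i q))"

lemma determined_by_angle_from_chart: "determined_by (i + 2) (angle_from_chart p i y)"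
proof (cases i)
  case 0
  then show ?thesis by (simp add: determined_by_def)
next
  case (Suc k)
  show ?thesis
    unfolding determined_by_def
  proof (intro allI impI)
    fix q q' :: point assume eq: "\<forall>j<i + 2. q j = q' j"
    have "mu p k q = mu p k q'" "nu p k q = nu p k q'" "eta p k q = eta p k q'"
      using determined_by_mu[of k p] determined_by_nu[of k p] determined_by_eta[of k p] eq Suc
      by (auto simp: determined_by_def)
    then show "angle_from_chart p i y q = angle_from_chart p i y q'"
      using eq Suc by simp
  qed
qed

text \<open>
  The relation \<open>y (s \<nu> + c \<eta>) = c \<mu>\<close> reads \<open>c (\<mu> - y \<eta>) = s \<nu> y\<close>. If \<open>\<mu> - y \<eta>\<close> were zero, then \<open>y = 0\<close>, as
  \<open>s\<close> and \<open>\<nu>\<close> are non-zero, and hence \<open>\<mu> = 0\<close>.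
\<close>

lemma singular_denominator_nonzero:
  assumes "\<forall>k\<le>Suc i. mu p k q \<noteq> 0" "right_angle (hinge (Suc i) p)"
    "\<bar>hinge (Suc i) q - branch_centre (hinge (Suc i) p)\<bar> < pi / 2"
  shows "mu p i q - phi p (Suc i) q * eta p i q \<noteq> 0"
    and "cos (hinge (Suc i) q) / sin (hinge (Suc i) q) =
           phi p (Suc i) q * nu p i q / (mu p i q - phi p (Suc i) q * eta p i q)"
proof -
  define y c s where "y = phi p (Suc i) q" and "c = cos (hinge (Suc i) q)" and "s = sin (hinge (Suc i) q)"
  have s: "s \<noteq> 0"
    unfolding s_def by (rule angle_eq_arctan_cot(1)[OF assms(2,3)])
  have nz: "mu p (Suc i) q \<noteq> 0" "mu p i q \<noteq> 0" "nu p i q \<noteq> 0"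
    using assms(1) nu_nonzero[of i p q] by (blast, simp_all add: le_SucI)
  have "y * (s * nu p i q + c * eta p i q) = c * mu p i q"
    using nz(1) assms(2) by (simp add: y_def c_def s_def)
  then have *: "c * (mu p i q - y * eta p i q) = s * (y * nu p i q)"
    by (simp add: algebra_simps)
  have den: "mu p i q - y * eta p i q \<noteq> 0"
  proof
    assume 0: "mu p i q - y * eta p i q = 0"
    then have "y = 0"
      using * s nz(3) by simp
    with 0 nz(2) show False
      by simp
  qed
  then show "mu p i q - phi p (Suc i) q * eta p i q \<noteq> 0"
    unfolding y_def .
  have "c / s = y * nu p i q / (mu p i q - y * eta p i q)"
    using * s den by (simp add: frac_eq_eq mult.commute)
  then show "cos (hinge (Suc i) q) / sin (hinge (Suc i) q) =
      phi p (Suc i) q * nu p i q / (mu p i q - phi p (Suc i) q * eta p i q)"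
    unfolding y_def c_def s_def .
qed

lemma angle_from_chart_phi:
  assumes "q \<in> chart_domain n p" "i \<le> n"
  shows "\<theta> i q = angle_from_chart p i (phi p i q) q"
proof (cases i)
  case 0
  have close: "\<bar>hinge 0 q - branch_centre (hinge 0 p)\<bar> < pi / 2"
    using assms by (simp add: chart_domain_def del: hinge.simps)
  show ?thesis
    using angle_eq_arctan_cot(2)[OF _ close] angle_eq_arctan_tan(2)[OF _ close] 0
    by (simp add: tan_def cot_def)
next
  case (Suc k)
  have close: "\<bar>hinge (Suc k) q - branch_centre (hinge (Suc k) p)\<bar> < pi / 2"
    and mu: "\<forall>l\<le>Suc k. mu p l q \<noteq> 0"
    using assms Suc by (auto simp: chart_domain_def simp del: mu.simps)
  have \<theta>: "\<theta> (Suc k) q = \<theta> k q + hinge (Suc k) q"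
    by simp
  show ?thesis
  proof (cases "right_angle (hinge (Suc k) p)")
    case True
    then show ?thesis
      unfolding Suc \<theta>
      using angle_eq_arctan_cot(2)[OF True close] singular_denominator_nonzero(2)[OF mu True close]
      by (simp del: hinge.simps phi.simps)
  next
    case False
    let ?c = "cos (hinge (Suc k) q)" and ?s = "sin (hinge (Suc k) q)"
    have "?c \<noteq> 0"
      by (rule angle_eq_arctan_tan(1)[OF False close])
    moreover have nz: "mu p k q \<noteq> 0" "nu p k q \<noteq> 0"
      using mu nu_nonzero[of k p q] by (simp_all add: le_SucI)
    moreover have "phi p (Suc k) q = (?s * nu p k q + ?c * eta p k q) / (?c * mu p k q)"
      using False by simp
    ultimately have "?s / ?c = (phi p (Suc k) q * mu p k q - eta p k q) / nu p k q"
      by (simp add: field_simps del: hinge.simps phi.simps)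
    then show ?thesis
      unfolding Suc \<theta> using angle_eq_arctan_tan(2)[OF False close] False
      by (simp del: hinge.simps phi.simps)
  qed
qed

text \<open>
  The map is triangular: each coordinate of \<open>q\<close> is a function of its image and of the earlier
  coordinates of \<open>q\<close>.
\<close>

lemma inj_on_phi_map: "inj_on (phi_map n p) (chart_domain n p)"
proof (rule inj_onI)
  fix q q' assume q: "q \<in> chart_domain n p" "q' \<in> chart_domain n p" and eq: "phi_map n p q = phi_map n p q'"
  have chart: "chart p j q = chart p j q'" if "j < n + 3" for j
    using fun_cong[OF eq, of j] that by (simp add: phi_map_eq_chart)
  have "q j = q' j" for j
  proof (induction j rule: less_induct)
    case (less j)
    consider "j = 0" | "j = 1" | i where "j = i + 2" "i \<le> n" | "j \<ge> n + 3"
      by (rule index_cases)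
    then show ?case
    proof cases
      case 3
      have "phi p i q = phi p i q'"
        using chart[of j] 3 by (simp add: chart_def)
      moreover have "angle_from_chart p i y q = angle_from_chart p i y q'" for y
        by (rule determined_byD[OF determined_by_angle_from_chart]) (use less 3 in simp)
      ultimately show ?thesis
        using angle_from_chart_phi[OF q(1) 3(2)] angle_from_chart_phi[OF q(2) 3(2)] 3(1) by simp
    next
      case 4
      then show ?thesis
        using q by (simp add: chart_domain_def angle_box_def topspace_Euclidean_space)
    qed (use chart[of 0] chart[of 1] in \<open>auto simp: chart_def split: if_splits\<close>)
  qed
  then show "q = q'" by auto
qed

lemma smooth_on_chart:
  assumes "j < n + 3"
  shows "smooth_on (n + 3) (chart_domain n p) (chart p j)"
proof (cases "j < 2")
  case True
  have "chart p j = (\<lambda>q. q 0) \<or> chart p j = (\<lambda>q. q 1)"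
    using True by (auto simp: chart_def fun_eq_iff less_2_cases_iff)
  then show ?thesis
    using smooth_on_coordinate[OF openin_chart_domain] by auto
next
  case False
  have "smooth_on (n + 3) (chart_domain n p) (phi p (j - 2))"
    using smooth_on_construction[OF openin_chart_domain, of "j - 2" n p p] assms False
    by (auto simp: chart_domain_def)
  moreover have "chart p j = phi p (j - 2)"
    using False by (simp add: chart_def fun_eq_iff)
  ultimately show ?thesis by simp
qed

text \<open>
  Invariance of domain gives that the image is open and the inverse continuous, without any
  description of the image. Then \<^const>\<open>angle_from_chart\<close> expresses each component of the inverse
  through the earlier ones, which makes all of them smooth.
\<close>

lemma diffeomorphism_phi_map:
  fixes n p
  defines "U \<equiv> chart_domain n p"
  shows "diffeomorphism (n + 3) U (phi_map n p ` U) (phi_map n p) (inv_into U (phi_map n p))"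
proof -
  let ?E = "Euclidean_space (n + 3)" and ?\<phi> = "phi_map n p"
  define V \<psi> where "V = ?\<phi> ` U" and "\<psi> = inv_into U ?\<phi>"
  have U: "openin ?E U"
    unfolding U_def by (rule openin_chart_domain)
  have inj: "inj_on ?\<phi> U"
    unfolding U_def by (rule inj_on_phi_map)
  have \<phi>: "smooth_on (n + 3) U (\<lambda>q. ?\<phi> q j)" if "j < n + 3" for j
    using smooth_on_chart[OF that, of p] that by (simp add: phi_map_eq_chart U_def)
  have "continuous_map (subtopology ?E U) ?E (\<lambda>q j. if j < n + 3 then ?\<phi> q j else 0)"
    unfolding continuous_map_componentwise_Euclidean_space
    using smooth_on_imp_continuous_on[OF U \<phi>] by (simp add: continuous_map_Euclidean_open_iff[OF U])
  moreover have "(\<lambda>q j. if j < n + 3 then ?\<phi> q j else 0) = ?\<phi>"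
    by (auto simp: fun_eq_iff phi_map_eq_chart)
  ultimately have cont: "continuous_map (subtopology ?E U) ?E ?\<phi>"
    by simp
  have V: "openin ?E V"
    unfolding V_def by (rule invariance_of_domain_Euclidean_space[OF U cont inj])
  have \<psi>\<phi>: "\<psi> (?\<phi> q) = q" if "q \<in> U" for q
    unfolding \<psi>_def using inj that by simp
  have \<phi>\<psi>: "?\<phi> (\<psi> x) = x" and \<psi>U: "\<psi> x \<in> U" if "x \<in> V" for x
    using that by (auto simp: V_def \<psi>\<phi>)
  have "embedding_map (subtopology ?E U) ?E ?\<phi>"
    by (rule invariance_of_domain_Euclidean_space_embedding_map[OF U cont inj])
  then obtain g where "homeomorphic_maps (subtopology ?E U) (subtopology ?E (?\<phi> ` topspace (subtopology ?E U))) ?\<phi> g"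
    by (auto simp: embedding_map_def homeomorphic_map_maps)
  moreover have top: "topspace (subtopology ?E U) = U" "topspace (subtopology ?E V) = V"
    using openin_subset[OF U] openin_subset[OF V] by auto
  ultimately have g: "continuous_map (subtopology ?E V) (subtopology ?E U) g" "\<And>q. q \<in> U \<Longrightarrow> g (?\<phi> q) = q"
    by (auto simp: homeomorphic_maps_def V_def)
  have "continuous_on V g"
    using g(1) cm_Euclidean_space_iff_continuous_on[of "n + 3" V "n + 3" g] top
    by (auto simp: continuous_map_in_subtopology)
  then have cont\<psi>: "continuous_on V \<psi>"
    by (rule continuous_on_eq) (use g(2) \<psi>\<phi> in \<open>auto simp: V_def\<close>)
  have \<psi>: "j < n + 3 \<longrightarrow> smooth_on (n + 3) V (\<lambda>x. \<psi> x j)" for j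
  proof (induction j rule: less_induct)
    case (less j)
    consider "j = 0" | "j = 1" | i where "j = i + 2" "i \<le> n" | "j \<ge> n + 3"
      by (rule index_cases)
    then show ?case
    proof cases
      case 3
      have x: "x j = phi p i (\<psi> x)" if "x \<in> V" for x
        using \<phi>\<psi>[OF that] 3 phi_map_eq_chart[of n p "\<psi> x" j] by (simp add: chart_def)
      have eq: "angle_from_chart p i (x j) (\<psi> x) = \<psi> x j" if "x \<in> V" for x
        using angle_from_chart_phi[of "\<psi> x" n p i] \<psi>U[OF that] 3 x[OF that] by (simp add: U_def)
      note intros = smooth_on_add[OF V] smooth_on_diff[OF V] smooth_on_mult[OF V] smooth_on_divide[OF V]
        smooth_on_arctan[OF V] smooth_on_const[OF V] smooth_on_coordinate[OF V]
      have "smooth_on (n + 3) V (\<lambda>x. angle_from_chart p i (x j) (\<psi> x))"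
      proof (cases i)
        case 0
        show ?thesis
          by (cases "right_angle (hinge 0 p)"; simp only: 0 angle_from_chart.simps if_True if_False)
            (intro intros)+
      next
        case (Suc k)
        have mu: "\<forall>l\<le>Suc k. mu p l (\<psi> x) \<noteq> 0" if "x \<in> V" for x
          using \<psi>U[OF that] 3 Suc by (auto simp: U_def chart_domain_def simp del: mu.simps)
        have sm: "smooth_on (n + 3) V (\<lambda>x. \<psi> x l)" if "l < k + 3" for l
          using less[of l] that 3 Suc by simp
        have "smooth_on (n + 3) U (mu p k) \<and> smooth_on (n + 3) U (nu p k) \<and> smooth_on (n + 3) U (eta p k)"
          using smooth_on_construction[OF U, of k p] 3 Suc by (auto simp: U_def chart_domain_def)
        moreover have "smooth_on (n + 3) V (\<lambda>x. f (\<psi> x))"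
          if "smooth_on (n + 3) U f" "determined_by (k + 3) f" for f
          by (rule smooth_on_compose[OF U V _ _ cont\<psi> that sm]) (use \<psi>U 3 Suc in auto)
        ultimately have f: "smooth_on (n + 3) V (\<lambda>x. mu p k (\<psi> x))"
          "smooth_on (n + 3) V (\<lambda>x. nu p k (\<psi> x))" "smooth_on (n + 3) V (\<lambda>x. eta p k (\<psi> x))"
          using determined_by_mu determined_by_nu determined_by_eta by blast+
        have nu: "nu p k (\<psi> x) \<noteq> 0" if "x \<in> V" for x
          using mu[OF that] by (intro nu_nonzero) (auto simp del: mu.simps)
        show ?thesis
        proof (cases "right_angle (hinge (Suc k) p)")
          case True
          have "mu p k (\<psi> x) - x j * eta p k (\<psi> x) \<noteq> 0" if "x \<in> V" for x
            using singular_denominator_nonzero(1)[OF mu[OF that] True] \<psi>U[OF that] 3 Suc x[OF that]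
            by (auto simp: U_def chart_domain_def simp del: mu.simps phi.simps hinge.simps)
          then show ?thesis
            unfolding Suc angle_from_chart.simps if_P[OF True]
            by (intro intros f sm) auto
        next
          case False
          show ?thesis
            unfolding Suc angle_from_chart.simps if_not_P[OF False]
            by (intro intros f sm nu) auto
        qed
      qed
      then show ?thesis
        using smooth_on_cong[OF V, of "\<lambda>x. angle_from_chart p i (x j) (\<psi> x)" "\<lambda>x. \<psi> x j"] eq by simp
    next
      case 1
      define l :: nat where "l = (if right_angle (\<theta> 0 p) then 1 else 0)"
      have "x l = \<psi> x j" if "x \<in> V" for x
        using \<phi>\<psi>[OF that] 1 phi_map_eq_chart[of n p "\<psi> x"] by (auto simp: chart_def l_def)
      then show ?thesis
        using smooth_on_cong[OF V, of "\<lambda>x. x l" "\<lambda>x. \<psi> x j"] smooth_on_coordinate[OF V] by simp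
    next
      case 2
      define l :: nat where "l = (if right_angle (\<theta> 0 p) then 0 else 1)"
      have "x l = \<psi> x j" if "x \<in> V" for x
        using \<phi>\<psi>[OF that] 2 phi_map_eq_chart[of n p "\<psi> x"] by (auto simp: chart_def l_def)
      then show ?thesis
        using smooth_on_cong[OF V, of "\<lambda>x. x l" "\<lambda>x. \<psi> x j"] smooth_on_coordinate[OF V] by simp
    qed simp
  qed
  have "\<psi> ` V = U"
    unfolding V_def using \<psi>\<phi> by (force simp: image_image)
  then show ?thesis
    unfolding diffeomorphism_def V_def[symmetric] \<psi>_def[symmetric]
    using U V \<psi>\<phi> \<phi>\<psi> \<phi> \<psi> by (auto simp: V_def)
qed

section \<open>Conversion of the trailer system\<close>

lemma distribution_triangular:
  assumes "f' x = (\<lambda>j. a * f x j)" "g' x = (\<lambda>j. b * f x j + c * g x j)" "a \<noteq> 0" "c \<noteq> 0"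
  shows "distribution f' g' x = distribution f g x"
proof -
  have "(\<lambda>j. s * f x j + t * g x j) =
      (\<lambda>j. ((s - t / c * b) / a) * f' x j + (t / c) * g' x j)" for s t
    using assms by (auto simp: fun_eq_iff field_simps)
  moreover have "(\<lambda>j. s * f' x j + t * g' x j) = (\<lambda>j. (s * a + t * b) * f x j + (t * c) * g x j)" for s t
    using assms by (auto simp: fun_eq_iff algebra_simps)
  ultimately show ?thesis
    unfolding distribution_def by blast
qed

theorem proposition3p2:
  fixes n :: nat
    and P :: "(real \<times> real) \<times> (nat \<Rightarrow> complex)"
    and p :: point
  assumes "P \<in> topspace (trailer_space n)"
    and "p \<in> topspace (Euclidean_space (n + 3))"
    and "trailer_point n p = P"
  shows "\<exists>\<kappa>\<^sub>1 \<kappa>\<^sub>2 U V \<psi>.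
     kumpera_ruiz (n + 3) (\<kappa>\<^sub>1, \<kappa>\<^sub>2) \<and>
     p \<in> U \<and> coordinate_domain n U \<and>
     (\<forall>i\<le>n. \<forall>q\<in>U. mu p i q \<noteq> 0) \<and>
     smooth_on (n + 3) U (nu p n) \<and>
     smooth_on (n + 3) U (eta p n) \<and>
     smooth_on (n + 3) U (mu p n) \<and>
     diffeomorphism (n + 3) U V (phi_map n p) \<psi> \<and>
     (\<forall>x\<in>V. pushforward (n + 3) (phi_map n p) \<psi> (\<tau>\<^sub>1 n) x =
             (\<lambda>j. nu p n (\<psi> x) * \<kappa>\<^sub>1 x j)) \<and>
     (\<forall>x\<in>V. pushforward (n + 3) (phi_map n p) \<psi> (\<tau>\<^sub>2 n) x =
             lin_comb (eta p n \<circ> \<psi>) \<kappa>\<^sub>1 (mu p n \<circ> \<psi>) \<kappa>\<^sub>2 x) \<and>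
     nu p n p \<noteq> 0 \<and> mu p n p \<noteq> 0 \<and>
     (\<forall>x\<in>V. distribution (pushforward (n + 3) (phi_map n p) \<psi> (\<tau>\<^sub>1 n))
                          (pushforward (n + 3) (phi_map n p) \<psi> (\<tau>\<^sub>2 n)) x =
             distribution \<kappa>\<^sub>1 \<kappa>\<^sub>2 x)"
proof -
  define \<kappa>\<^sub>2 where "\<kappa>\<^sub>2 = snd (trailer_normal_form p n)"
  define U where "U = chart_domain n p"
  define V where "V = phi_map n p ` U"
  define \<psi> where "\<psi> = inv_into U (phi_map n p)"
  have "(coord_field (n + 2), \<kappa>\<^sub>2) = trailer_normal_form p n"
    by (metis \<kappa>\<^sub>2_def fst_trailer_normal_form prod.collapse)
  then have kr: "kumpera_ruiz (n + 3) (coord_field (n + 2), \<kappa>\<^sub>2)"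
    using kumpera_ruiz_trailer_normal_form by simp
  have mu: "\<forall>k\<le>n. mu p k q \<noteq> 0" if "q \<in> U" for q
    using that by (simp add: U_def chart_domain_def)
  have U: "openin (Euclidean_space (n + 3)) U"
    unfolding U_def by (rule openin_chart_domain)
  have pU: "p \<in> U"
    using assms(2) branch_centre_close mu_nonzero_base_point
    by (auto simp: U_def chart_domain_def angle_box_def)
  have dom: "coordinate_domain n U"
    by (rule coordinate_domain_subset_angle_box[OF U]) (auto simp: U_def chart_domain_def)
  have smooth: "smooth_on (n + 3) U (nu p n)" "smooth_on (n + 3) U (eta p n)" "smooth_on (n + 3) U (mu p n)"
    using smooth_on_construction[OF U, of n p] mu by auto
  have diffeo: "diffeomorphism (n + 3) U V (phi_map n p) \<psi>"
    unfolding U_def V_def \<psi>_def by (rule diffeomorphism_phi_map)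
  have \<psi>: "\<psi> x \<in> U" "phi_map n p (\<psi> x) = x" if "x \<in> V" for x
    using diffeo that by (auto simp: diffeomorphism_def)
  have x: "x j = chart p j (\<psi> x)" if "x \<in> V" "j < n + 3" for x j
    using \<psi>(2)[OF that(1)] that(2) phi_map_eq_chart[of n p "\<psi> x" j] by simp
  have push: "pushforward (n + 3) (phi_map n p) \<psi> f x j =
      (if j < n + 3 then Lie_deriv (n + 3) f (chart p j) (\<psi> x) else 0)" for f x j
    by (auto simp: pushforward_def phi_map_eq_chart)
  have push1: "pushforward (n + 3) (phi_map n p) \<psi> (\<tau>\<^sub>1 n) x = (\<lambda>j. nu p n (\<psi> x) * coord_field (n + 2) x j)"
    if "x \<in> V" for x
    using Lie_deriv_\<tau>\<^sub>1_chart[of n "n + 3" p "\<psi> x" _ x] mu[OF \<psi>(1)[OF that]]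
    by (auto simp: push fun_eq_iff coord_field_def)
  have push2: "pushforward (n + 3) (phi_map n p) \<psi> (\<tau>\<^sub>2 n) x =
      lin_comb (eta p n \<circ> \<psi>) (coord_field (n + 2)) (mu p n \<circ> \<psi>) \<kappa>\<^sub>2 x" if "x \<in> V" for x
    using Lie_deriv_\<tau>\<^sub>2_chart[of n "n + 3" p "\<psi> x" x] mu[OF \<psi>(1)[OF that]] x[OF that]
      snd_trailer_normal_form_beyond[of n _ p x]
    by (auto simp: push fun_eq_iff coord_field_def lin_comb_def \<kappa>\<^sub>2_def)
  have nu: "nu p n q \<noteq> 0" if "q \<in> U" for q
    by (rule nu_nonzero[OF mu[OF that]])
  have "distribution (pushforward (n + 3) (phi_map n p) \<psi> (\<tau>\<^sub>1 n))
      (pushforward (n + 3) (phi_map n p) \<psi> (\<tau>\<^sub>2 n)) x = distribution (coord_field (n + 2)) \<kappa>\<^sub>2 x"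
    if "x \<in> V" for x
    using distribution_triangular[of "pushforward (n + 3) (phi_map n p) \<psi> (\<tau>\<^sub>1 n)" x "nu p n (\<psi> x)"
        "coord_field (n + 2)" "pushforward (n + 3) (phi_map n p) \<psi> (\<tau>\<^sub>2 n)" "eta p n (\<psi> x)"
        "mu p n (\<psi> x)" \<kappa>\<^sub>2]
      push1[OF that] push2[OF that] nu[OF \<psi>(1)[OF that]] mu[OF \<psi>(1)[OF that]]
    by (simp add: lin_comb_def)
  then show ?thesis
    using kr pU dom mu smooth diffeo push1 push2 nu[OF pU] by blast
qed

end
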